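(* Let $F_1(s),F_2(s)$ be orthogonal functions both satisfying (I) and (II), let $c_1,c_2\in\mathbb{C}\setminus\{0\}$, and let $L(s)=c_1F_1(s)+c_2F_2(s)$. Then $L(s)$ has no isolated vertical lines containing zeros in the half-plane $\sigma>1$.
   Context: Write $s=\sigma+it$. For a complex function $F(s)$ consider: (I) $F(s)=\sum_{n=1}^\infty a_F(n)n^{-s}$ is absolutely convergent for $\sigma>1$; (II) $\log F(s)=\sum_p\sum_{k=1}^\infty b_F(p^k)p^{-ks}$ (sum over primes $p$) is absolutely convergent for $\sigma>1$, with $|b_F(p^k)|\ll p^{k\theta}$ for every prime $p$ and every $k\geq1$, for some $\theta<\frac12$. Functions $F_1,\ldots,F_N$ satisfying (I) are called orthogonal if $\sum_{p\leq x}\frac{a_{F_i}(p)\overline{a_{F_j}(p)}}{p}=(m_{i,j}+o(1))\log\log x$ as $x\to\infty$, with $m_{i,i}>0$ and $m_{i,j}=0$ for $i\neq j$. A vertical line $\sigma=\beta_0$ (with $\beta_0>1$) is an isolated vertical line containing zeros of $L$ if $L$ has a zero with real part $\beta_0$ and there is $\delta>0$ such that $L$ has no zeros $\beta+i\gamma$ with $0<|\beta-\beta_0|<\delta$. *)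

theory Defs
  imports
    "HOL-Complex_Analysis.Complex_Analysis"
    "HOL-Computational_Algebra.Primes"
    "HOL-Library.Landau_Symbols"
begin

definition dirichlet_series_for :: "(nat \<Rightarrow> complex) \<Rightarrow> (complex \<Rightarrow> complex) \<Rightarrow> bool" where
  "dirichlet_series_for a F \<longleftrightarrow>
     (\<forall>s. Re s > 1 \<longrightarrow>
        (\<lambda>n. norm (a n * of_nat n powr (- s))) summable_on {1..} \<and>
        F s = (\<Sum>\<^sub>\<infinity>n\<in>{1..}. a n * of_nat n powr (- s)))"

definition condition_I :: "(complex \<Rightarrow> complex) \<Rightarrow> bool" where
  "condition_I F \<longleftrightarrow> (\<exists>a. dirichlet_series_for a F)"

text \<open>
  The values of a function on \<open>\<sigma> > 1\<close> can wind around the origin, so \<open>log F\<close> cannot be the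
  principal logarithm \<open>Ln \<circ> F\<close>; it is a holomorphic branch of the logarithm of \<open>F\<close>. The series
  in \<open>condition_II\<close> tends to 0 as \<open>\<sigma> \<rightarrow> \<infinity>\<close>, so it selects the branch with this normalisation.
\<close>

definition log_branch :: "(complex \<Rightarrow> complex) \<Rightarrow> (complex \<Rightarrow> complex) \<Rightarrow> bool" where
  "log_branch F g \<longleftrightarrow>
     g holomorphic_on {s. Re s > 1} \<and> (\<forall>s. Re s > 1 \<longrightarrow> exp (g s) = F s)"

text \<open>
  Only the values of \<open>b\<close> at prime powers matter. The constant \<open>C\<close> implied by the bound on
  \<open>b\<close> is uniform in \<open>p\<close> and \<open>k\<close>.
\<close>

definition condition_II :: "(complex \<Rightarrow> complex) \<Rightarrow> bool" where
  "condition_II F \<longleftrightarrow>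
     (\<exists>logF b. log_branch F logF \<and>
        (\<forall>s. Re s > 1 \<longrightarrow>
           (\<lambda>(p, k). norm (b (p ^ k) * of_nat p powr (- (of_nat k * s))))
              summable_on ({p. prime p} \<times> {1..}) \<and>
           logF s = (\<Sum>\<^sub>\<infinity>p\<in>{p. prime p}. \<Sum>\<^sub>\<infinity>k\<in>{1..}.
                       b (p ^ k) * of_nat p powr (- (of_nat k * s)))) \<and>
        (\<exists>\<theta> C :: real. \<theta> < 1 / 2 \<and>
           (\<forall>p k. prime p \<longrightarrow> k \<ge> 1 \<longrightarrow>
              norm (b (p ^ k) :: complex) \<le> C * real p powr (real k * \<theta>))))"

text \<open>
  The coefficients \<open>a i\<close> are uniquely determined by \<open>Fs ! i\<close> at indices \<open>n \<ge> 1\<close>, so the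
  existential quantifier over \<open>a\<close> involves no choice.
\<close>

definition orthogonal_functions :: "(complex \<Rightarrow> complex) list \<Rightarrow> bool" where
  "orthogonal_functions Fs \<longleftrightarrow>
     (\<exists>(a :: nat \<Rightarrow> nat \<Rightarrow> complex) (m :: nat \<Rightarrow> nat \<Rightarrow> real).
        (\<forall>i < length Fs. dirichlet_series_for (a i) (Fs ! i)) \<and>
        (\<forall>i < length Fs. \<forall>j < length Fs.
           (\<lambda>x :: real. (\<Sum>p | prime p \<and> real p \<le> x. a i p * cnj (a j p) / of_nat p)
                - of_real (m i j) * of_real (ln (ln x)))
             \<in> o[at_top](\<lambda>x. of_real (ln (ln x)))) \<and>
        (\<forall>i < length Fs. m i i > 0) \<and>
        (\<forall>i < length Fs. \<forall>j < length Fs. i \<noteq> j \<longrightarrow> m i j = 0))"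

text \<open>
  The number \<open>\<delta>\<close> may always be decreased, so for \<open>\<beta>\<^sub>0 > 1\<close> the values of \<open>L\<close> outside the half-plane
  \<open>\<sigma> > 1\<close> are irrelevant.
\<close>

definition isolated_zero_line :: "(complex \<Rightarrow> complex) \<Rightarrow> real \<Rightarrow> bool" where
  "isolated_zero_line L \<beta>\<^sub>0 \<longleftrightarrow>
     (\<exists>\<rho>. Re \<rho> = \<beta>\<^sub>0 \<and> L \<rho> = 0) \<and>
     (\<exists>\<delta> > 0. \<not> (\<exists>\<rho>. L \<rho> = 0 \<and> 0 < \<bar>Re \<rho> - \<beta>\<^sub>0\<bar> \<and> \<bar>Re \<rho> - \<beta>\<^sub>0\<bar> < \<delta>))"

end

theory Submission
  imports Defs "HOL-Real_Asymp.Real_Asymp"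
begin

text \<open>
  Write \<open>F\<^sub>i = exp g\<^sub>i\<close> and \<open>G = g\<^sub>1 - g\<^sub>2 = \<Sum>\<^sub>p \<phi>\<^sub>p(p\<^bsup>-s\<^esup>)\<close>, where \<open>\<phi>\<^sub>p\<close> is a power series in \<open>p\<^bsup>-s\<^esup>\<close>. The
  zeros of \<open>L\<close> are the solutions of \<open>exp (G s) = - c\<^sub>2 / c\<^sub>1\<close>, so it suffices that if \<open>G\<close> takes a value
  \<open>v\<close> at \<open>\<rho>\<close>, then it takes this value on vertical lines arbitrarily close to that of \<open>\<rho>\<close>. By
  Kronecker's theorem and Hurwitz's theorem, \<open>G\<close> may be replaced by its twists, in which the \<open>p\<^bsup>-s\<^esup>\<close>
  are multiplied by independent unimodular numbers. Solve \<open>\<phi>\<^sub>p(z(s)) = v - G(s) + \<phi>\<^sub>p(p\<^bsup>-s\<^esup>)\<close> near \<open>\<rho>\<close>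
  for one large prime \<open>p\<close>. If no twist takes the value \<open>v\<close> off the line, then \<open>|p\<^bsup>s\<^esup> z(s)| > 1\<close> off the
  line, with value 1 at \<open>\<rho>\<close>, and the maximum modulus principle for \<open>1 / (p\<^bsup>s\<^esup> z(s))\<close> gives a
  contradiction. Orthogonality guarantees that \<open>\<Sum> |a\<^sub>1(p) - a\<^sub>2(p)|\<^sup>2 / p\<close> diverges, which with
  \<open>a\<^sub>i(p) = b\<^sub>i(p)\<close> provides arbitrarily large primes with \<open>\<phi>\<^sub>p'(p\<^bsup>-\<rho>\<^esup>) \<noteq> 0\<close>.
\<close>

section \<open>Kronecker approximation by \<open>n\<^bsup>-it\<^esup>\<close>\<close>

text \<open>Unique factorisation: \<open>A\<close> collects the primes with positive coefficients
  and \<open>B\<close> those with negative ones, as \<open>nat\<close> truncates at 0. The relation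
  says \<open>ln A = ln B\<close>, so \<open>A = B\<close>, and comparing multiplicities leaves only
  the coefficient 0.\<close>

lemma int_lincomb_ln_primes_eq_0:
  fixes u :: "nat \<Rightarrow> int"
  assumes fin: "finite P" and P: "\<And>p. p \<in> P \<Longrightarrow> prime p"
    and sum0: "(\<Sum>p\<in>P. of_int (u p) * ln (real p)) = 0" and "p \<in> P"
  shows "u p = 0"
proof -
  define A where "A = (\<Prod>p\<in>P. p ^ nat (u p))"
  define B where "B = (\<Prod>p\<in>P. p ^ nat (- u p))"
  have pos: "p > 0" if "p \<in> P" for p
    using P[OF that] by (simp add: prime_gt_0_nat)
  have "A > 0" "B > 0"
    unfolding A_def B_def using pos by (auto intro!: prod_pos)
  have lnA: "ln (real A) = (\<Sum>p\<in>P. real (nat (u p)) * ln (real p))"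
    unfolding A_def of_nat_prod using fin pos by (subst ln_prod) (auto simp: ln_realpow)
  have lnB: "ln (real B) = (\<Sum>p\<in>P. real (nat (- u p)) * ln (real p))"
    unfolding B_def of_nat_prod using fin pos by (subst ln_prod) (auto simp: ln_realpow)
  have "real (nat k) - real (nat (- k)) = of_int k" for k
    by linarith
  then have "ln (real A) - ln (real B) = 0"
    unfolding lnA lnB sum_subtractf[symmetric] left_diff_distrib[symmetric] using sum0 by simp
  then have "A = B"
    using \<open>A > 0\<close> \<open>B > 0\<close> by simp
  moreover have "multiplicity p A = nat (u p)" "multiplicity p B = nat (- u p)"
    unfolding A_def B_def using fin P \<open>p \<in> P\<close>
    by (simp_all add: multiplicity_prod_prime_powers)
  ultimately have "nat (u p) = nat (- u p)"
    by simp
  then show ?thesis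
    by linarith
qed

text \<open>Brings the preceding lemma into the form that Kronecker's theorem requires. The factor
  \<open>c\<close> will be \<open>- 1 / (2 * pi)\<close>.\<close>

lemma independent_ln_primes:
  assumes fin: "finite P" and P: "\<And>p::nat. p \<in> P \<Longrightarrow> prime p" and "c \<noteq> 0"
  shows "module.independent (\<lambda>r. (*) (real_of_int r)) ((\<lambda>p. c * ln (real p)) ` P)"
proof -
  interpret Modules.module "\<lambda>r. (*) (real_of_int r)"
    by (simp add: Modules.module.intro distrib_left mult.commute)
  have inj: "inj_on (\<lambda>p. c * ln (real p)) P"
    using P \<open>c \<noteq> 0\<close> by (auto intro!: inj_onI simp: prime_gt_0_nat)
  show ?thesis
  proof (subst independent_explicit_module, intro allI impI)
    fix T u v
    assume T: "finite T" "T \<subseteq> (\<lambda>p. c * ln (real p)) ` P"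
      and s0: "(\<Sum>v\<in>T. real_of_int (u v) * v) = 0" and "v \<in> T"
    obtain Q where Q: "Q \<subseteq> P" "T = (\<lambda>p. c * ln (real p)) ` Q"
      using T(2) by (auto simp: subset_image_iff)
    obtain p where p: "p \<in> Q" "v = c * ln (real p)"
      using Q(2) \<open>v \<in> T\<close> by blast
    have "0 = (\<Sum>p\<in>Q. real_of_int (u (c * ln (real p))) * (c * ln (real p)))"
      using s0 unfolding Q(2) by (subst (asm) sum.reindex) (auto intro: inj_on_subset[OF inj Q(1)])
    also have "\<dots> = c * (\<Sum>p\<in>Q. real_of_int (u (c * ln (real p))) * ln (real p))"
      by (simp add: sum_distrib_left mult_ac)
    finally have "(\<Sum>p\<in>Q. real_of_int (u (c * ln (real p))) * ln (real p)) = 0"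
      using \<open>c \<noteq> 0\<close> by simp
    then show "u v = 0"
      using int_lincomb_ln_primes_eq_0[of Q "\<lambda>p. u (c * ln (real p))" p] p Q(1) P
        finite_subset[OF Q(1) fin] by auto
  qed
qed

lemma norm_cis_diff_le: "norm (cis x - cis y) \<le> \<bar>x - y\<bar>"
proof -
  have "cis x - cis y = cis y * (exp (\<i> * of_real (x - y)) - 1)"
    by (simp add: algebra_simps cis_conv_exp exp_diff)
  then show ?thesis
    using dist_exp_i_1[of "x - y"] abs_sin_x_le_abs_x[of "(x - y) / 2"]
    by (simp add: norm_mult dist_norm)
qed

text \<open>The number \<open>p powr (-it)\<close> is \<open>cis (2 * pi * t * \<theta>)\<close>
  with \<open>\<theta> = - ln p / (2 * pi)\<close>. Approximating unimodular numbers thus means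
  approximating their arguments modulo 1, which Kronecker's theorem does for independent
  frequencies.\<close>

lemma simultaneous_prime_power_approx:
  fixes w :: "nat \<Rightarrow> complex"
  assumes fin: "finite P" and P: "\<And>p. p \<in> P \<Longrightarrow> prime p"
    and w: "\<And>p. p \<in> P \<Longrightarrow> norm (w p) = 1" and "\<epsilon> > 0"
  obtains t :: real where "\<And>p. p \<in> P \<Longrightarrow> norm (of_nat p powr (- (\<i> * of_real t)) - w p) < \<epsilon>"
proof -
  obtain e where e: "bij_betw e {..<card P} P"
    using ex_bij_betw_nat_finite[OF fin] by (auto simp: atLeast0LessThan)
  define c where "c = - 1 / (2 * pi)"
  have "c \<noteq> 0" by (simp add: c_def)
  define \<theta> where "\<theta> i = c * ln (real (e i))" for i
  have eP: "e i \<in> P" if "i < card P" for i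
    using e that by (auto simp: bij_betw_def)
  have im: "\<theta> ` {..<card P} = (\<lambda>p. c * ln (real p)) ` P"
  proof -
    have "\<theta> ` {..<card P} = (\<lambda>p. c * ln (real p)) ` (e ` {..<card P})"
      unfolding image_image \<theta>_def ..
    then show ?thesis
      using bij_betw_imp_surj_on[OF e] by simp
  qed
  have inj: "inj_on \<theta> {..<card P}"
  proof (rule inj_onI)
    fix i j assume ij: "i \<in> {..<card P}" "j \<in> {..<card P}" "\<theta> i = \<theta> j"
    then have "e i = e j"
      using \<open>c \<noteq> 0\<close> P[OF eP] by (auto simp: \<theta>_def prime_gt_0_nat)
    then show "i = j"
      using e ij by (auto simp: bij_betw_def inj_on_def)
  qed
  define \<alpha> where "\<alpha> i = Arg (w (e i)) / (2 * pi)" for i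
  \<comment> \<open>The tolerance is divided by \<open>2 * pi\<close> because \<open>cis\<close> is
    1-Lipschitz and is applied to \<open>2 * pi\<close> times these quantities.\<close>
  obtain t h where th: "\<And>i. i < card P \<Longrightarrow> \<bar>t * \<theta> i - of_int (h i) - \<alpha> i\<bar> < \<epsilon> / (2 * pi)"
    using Kronecker_thm_1[of \<theta> "card P" "\<epsilon> / (2 * pi)" \<alpha>] independent_ln_primes[OF fin P \<open>c \<noteq> 0\<close>]
      inj \<open>\<epsilon> > 0\<close> unfolding im by auto
  show thesis
  proof
    fix p assume "p \<in> P"
    then obtain i where i: "i < card P" "p = e i"
      using e by (auto simp: bij_betw_def)
    have p0: "p > 0" using P[OF \<open>p \<in> P\<close>] by (simp add: prime_gt_0_nat)
    have "of_nat p powr (- (\<i> * of_real t)) = cis (- (t * ln (real p)))"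
      using p0 by (simp add: powr_def cis_conv_exp Ln_of_nat mult_ac)
    also have "- (t * ln (real p)) = 2 * pi * (t * \<theta> i)"
      by (simp add: \<theta>_def c_def i)
    also have "cis \<dots> = cis (2 * pi * (t * \<theta> i - of_int (h i)))"
    proof -
      have "cis (2 * pi * (t * \<theta> i)) = cis (2 * pi * (t * \<theta> i - of_int (h i))) * cis (2 * pi * of_int (h i))"
        by (simp add: cis_mult algebra_simps)
      also have "cis (2 * pi * of_int (h i)) = 1"
        by (rule cis_multiple_2pi) auto
      finally show ?thesis by simp
    qed
    finally have 1: "of_nat p powr (- (\<i> * of_real t)) = cis (2 * pi * (t * \<theta> i - of_int (h i)))" .
    have "w p \<noteq> 0" using w[OF \<open>p \<in> P\<close>] by auto
    then have 2: "w p = cis (2 * pi * \<alpha> i)"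
      using w[OF \<open>p \<in> P\<close>] cis_Arg[of "w p"] by (simp add: \<alpha>_def i sgn_eq)
    have "norm (of_nat p powr (- (\<i> * of_real t)) - w p)
            \<le> \<bar>2 * pi * (t * \<theta> i - of_int (h i)) - 2 * pi * \<alpha> i\<bar>"
      unfolding 1 2 by (rule norm_cis_diff_le)
    also have "\<dots> = 2 * pi * \<bar>t * \<theta> i - of_int (h i) - \<alpha> i\<bar>"
      by (simp flip: right_diff_distrib add: abs_mult)
    also have "\<dots> < \<epsilon>"
      using th[OF i(1)] by (simp add: field_simps)
    finally show "norm (of_nat p powr (- (\<i> * of_real t)) - w p) < \<epsilon>" .
  qed
qed

text \<open>Complete multiplicativity is required, so the values at primes determine those at all
  \<open>n > 0\<close>. The value at 0 is left free, since the term at \<open>n = 0\<close> of a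
  series vanishes.\<close>

definition unimodular_multiplicative :: "(nat \<Rightarrow> complex) \<Rightarrow> bool" where
  "unimodular_multiplicative \<psi> \<longleftrightarrow>
     (\<forall>n>0. norm (\<psi> n) = 1) \<and> (\<forall>m>0. \<forall>n>0. \<psi> (m * n) = \<psi> m * \<psi> n)"

text \<open>One number \<open>\<tau> j\<close> serves all primes up to \<open>j\<close> with error
  below \<open>1 / (j + 1)\<close>. This gives convergence at every prime, and multiplicativity of
  both sides extends it to all \<open>n > 0\<close>.\<close>

lemma unimodular_multiplicative_approx:
  assumes "unimodular_multiplicative \<psi>"
  obtains \<tau> :: "nat \<Rightarrow> real" where
    "\<And>n. n > 0 \<Longrightarrow> (\<lambda>j. of_nat n powr (- (\<i> * of_real (\<tau> j)))) \<longlonglongrightarrow> \<psi> n"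
proof -
  have "\<exists>t::real. \<forall>p\<in>{p. prime p \<and> p \<le> j}. norm (of_nat p powr (- (\<i> * of_real t)) - \<psi> p) < 1 / real (Suc j)"
    (is "\<exists>t. ?P j t") for j :: nat
  proof -
    obtain t :: real where "\<And>p. p \<in> {p. prime p \<and> p \<le> j} \<Longrightarrow>
        norm (of_nat p powr (- (\<i> * of_real t)) - \<psi> p) < 1 / real (Suc j)"
    proof (rule simultaneous_prime_power_approx[of "{p. prime p \<and> p \<le> j}" \<psi> "1 / real (Suc j)"])
      show "norm (\<psi> p) = 1" if "p \<in> {p. prime p \<and> p \<le> j}" for p
        using assms that by (simp add: unimodular_multiplicative_def prime_gt_0_nat)
    qed auto
    then show ?thesis by blast
  qed
  then have "\<exists>\<tau>. \<forall>j. ?P j (\<tau> j)"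
    by (intro choice) blast
  then obtain \<tau> :: "nat \<Rightarrow> real" where "\<forall>j. ?P j (\<tau> j)"
    by blast
  then have \<tau>:
    "\<And>j p. prime p \<Longrightarrow> p \<le> j \<Longrightarrow> norm (of_nat p powr (- (\<i> * of_real (\<tau> j))) - \<psi> p) < 1 / real (Suc j)"
    by blast
  have mult: "\<psi> (m * n) = \<psi> m * \<psi> n" if "m > 0" "n > 0" for m n
    using assms that by (simp add: unimodular_multiplicative_def)
  have norm1: "norm (\<psi> n) = 1" if "n > 0" for n
    using assms that by (simp add: unimodular_multiplicative_def)
  have "\<psi> 1 * \<psi> 1 = \<psi> 1" "\<psi> 1 \<noteq> 0"
    using mult[of 1 1] norm1[of 1] by auto
  then have \<psi>1: "\<psi> 1 = 1" by simp
  have "(\<lambda>j. of_nat n powr (- (\<i> * of_real (\<tau> j)))) \<longlonglongrightarrow> \<psi> n" if "n > 0" for n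
    using that
  proof (induction n rule: prime_divisors_induct)
    case (unit x)
    then show ?case using \<psi>1 by simp
  next
    case (factor p x)
    have "(\<lambda>j. of_nat p powr (- (\<i> * of_real (\<tau> j))) - \<psi> p) \<longlonglongrightarrow> 0"
    proof (rule Lim_null_comparison)
      show "eventually (\<lambda>j. norm (of_nat p powr (- (\<i> * of_real (\<tau> j))) - \<psi> p) \<le> 1 / real (Suc j)) sequentially"
        using eventually_ge_at_top[of p] by eventually_elim (use \<tau> factor in \<open>auto intro: less_imp_le\<close>)
      show "(\<lambda>j. 1 / real (Suc j)) \<longlonglongrightarrow> 0"
        using LIMSEQ_inverse_real_of_nat by (simp add: inverse_eq_divide)
    qed
    then have "(\<lambda>j. of_nat p powr (- (\<i> * of_real (\<tau> j)))) \<longlonglongrightarrow> \<psi> p"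
      by (simp add: LIM_zero_iff)
    moreover have "x > 0" "p > 0" using factor by auto
    ultimately have "(\<lambda>j. of_nat p powr (- (\<i> * of_real (\<tau> j))) * of_nat x powr (- (\<i> * of_real (\<tau> j)))) \<longlonglongrightarrow> \<psi> p * \<psi> x"
      using factor by (intro tendsto_mult) auto
    moreover have "\<psi> (p * x) = \<psi> p * \<psi> x"
      using \<open>x > 0\<close> \<open>p > 0\<close> by (rule mult[rotated])
    moreover have "of_nat (p * x) powr s = of_nat p powr s * of_nat x powr s" for s :: complex
      using \<open>x > 0\<close> \<open>p > 0\<close> by (simp add: powr_times_real)
    ultimately show ?case by simp
  qed simp_all
  then show thesis by (rule that)
qed

section \<open>Twists of absolutely convergent Dirichlet series\<close>

text \<open>The term at \<open>n = 0\<close> vanishes, because \<open>0 powr z = 0\<close>.\<close>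

definition dser :: "(nat \<Rightarrow> complex) \<Rightarrow> complex \<Rightarrow> complex" where
  "dser a s = (\<Sum>n. a n * of_nat n powr (- s))"

text \<open>Real exponents suffice, because \<open>n powr (- s)\<close> has modulus
  \<open>n powr (- Re s)\<close>.\<close>

definition dser_abs_conv :: "(nat \<Rightarrow> complex) \<Rightarrow> bool" where
  "dser_abs_conv a \<longleftrightarrow> (\<forall>\<sigma>>1. summable (\<lambda>n. norm (a n) * real n powr (- \<sigma>)))"

lemma norm_of_nat_powr: "norm (of_nat n powr (s :: complex)) = real n powr Re s"
  by (simp add: norm_powr_real_powr)

lemma of_nat_powr_shift:
  "of_nat n powr (- (s + w)) = of_nat n powr (- s) * (of_nat n powr (- w) :: complex)"
  by (simp flip: powr_add)

lemma dser_abs_conv_summable_norm: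
  assumes "dser_abs_conv a" "Re s > 1"
  shows "summable (\<lambda>n. norm (a n * of_nat n powr (- s)))"
  using assms by (simp add: dser_abs_conv_def norm_mult norm_of_nat_powr)

lemma dser_abs_conv_summable:
  assumes "dser_abs_conv a" "Re s > 1"
  shows "summable (\<lambda>n. a n * of_nat n powr (- s))"
  using dser_abs_conv_summable_norm[OF assms] by (rule summable_norm_cancel)

lemma dser_abs_conv_mult_bounded:
  assumes "dser_abs_conv a" and K: "\<And>n. n > 0 \<Longrightarrow> norm (f n) \<le> K"
  shows "dser_abs_conv (\<lambda>n. a n * f n)"
  unfolding dser_abs_conv_def
proof (intro allI impI)
  fix \<sigma> :: real assume "\<sigma> > 1"
  then have "summable (\<lambda>n. K * (norm (a n) * real n powr (- \<sigma>)))"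
    using assms(1) by (auto simp: dser_abs_conv_def intro: summable_mult)
  moreover have "norm (a n * f n) * real n powr (- \<sigma>) \<le> K * (norm (a n) * real n powr (- \<sigma>))" for n
  proof (cases "n = 0")
    case False
    then have "norm (f n) * (norm (a n) * real n powr (- \<sigma>)) \<le> K * (norm (a n) * real n powr (- \<sigma>))"
      by (intro mult_right_mono K) auto
    then show ?thesis by (simp add: norm_mult mult_ac)
  qed simp
  ultimately show "summable (\<lambda>n. norm (a n * f n) * real n powr (- \<sigma>))"
    by - (rule summable_comparison_test'[where N = 0], assumption, simp)
qed

lemma dser_abs_conv_twist:
  assumes "dser_abs_conv a" "unimodular_multiplicative \<psi>"
  shows "dser_abs_conv (\<lambda>n. a n * \<psi> n)"
  using assms by (intro dser_abs_conv_mult_bounded[of a \<psi> 1]) (auto simp: unimodular_multiplicative_def)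

lemma dser_abs_conv_diff:
  assumes "dser_abs_conv a" "dser_abs_conv b"
  shows "dser_abs_conv (\<lambda>n. a n - b n)"
  unfolding dser_abs_conv_def
proof (intro allI impI)
  fix \<sigma> :: real assume "\<sigma> > 1"
  then have "summable (\<lambda>n. norm (a n) * real n powr (- \<sigma>) + norm (b n) * real n powr (- \<sigma>))"
    using assms by (auto simp: dser_abs_conv_def intro: summable_add)
  moreover have "norm (a n - b n) * real n powr (- \<sigma>)
      \<le> norm (a n) * real n powr (- \<sigma>) + norm (b n) * real n powr (- \<sigma>)" for n
    using mult_right_mono[OF norm_triangle_ineq4[of "a n" "b n"], of "real n powr (- \<sigma>)"]
    by (simp add: distrib_right)
  ultimately show "summable (\<lambda>n. norm (a n - b n) * real n powr (- \<sigma>))"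
    by - (rule summable_comparison_test'[where N = 0], assumption, simp)
qed

lemma dser_diff:
  assumes "dser_abs_conv a" "dser_abs_conv b" "Re s > 1"
  shows "dser (\<lambda>n. a n - b n) s = dser a s - dser b s"
  unfolding dser_def left_diff_distrib
  by (intro suminf_diff[symmetric] dser_abs_conv_summable assms)

text \<open>A translation by \<open>\<i> * \<tau> j\<close> multiplies the \<open>n\<close>-th term
  by a number tending to \<open>\<psi> n\<close>. Tannery's theorem sums these termwise
  limits.\<close>

lemma dser_twist_uniform_limit:
  assumes a: "dser_abs_conv a" and \<psi>: "unimodular_multiplicative \<psi>" and "\<sigma> > 1"
    and \<tau>: "\<And>n. n > 0 \<Longrightarrow> (\<lambda>j. of_nat n powr (- (\<i> * of_real (\<tau> j)))) \<longlonglongrightarrow> \<psi> n"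
  shows "uniform_limit {s. Re s \<ge> \<sigma>} (\<lambda>j s. dser a (s + \<i> * of_real (\<tau> j)))
           (dser (\<lambda>n. a n * \<psi> n)) sequentially"
proof -
  \<comment> \<open>A majorant of the \<open>n\<close>-th term of the error that does not depend on
    \<open>s\<close>; this is what makes the limit uniform.\<close>
  define E where "E n j = norm (a n) * real n powr (- \<sigma>) *
                            norm (of_nat n powr (- (\<i> * of_real (\<tau> j))) - \<psi> n)" for n j
  have Ebound: "E n j \<le> 2 * (norm (a n) * real n powr (- \<sigma>))" for n j
  proof (cases "n = 0")
    case False
    then have "norm (of_nat n powr (- (\<i> * of_real (\<tau> j))) - \<psi> n) \<le> 1 + 1"
      using \<psi> by (intro norm_triangle_le_diff add_mono) (auto simp: norm_of_nat_powr unimodular_multiplicative_def)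
    then have "(norm (a n) * real n powr (- \<sigma>)) * norm (of_nat n powr (- (\<i> * of_real (\<tau> j))) - \<psi> n)
             \<le> (norm (a n) * real n powr (- \<sigma>)) * 2"
      by (intro mult_left_mono) auto
    then show ?thesis by (simp add: E_def mult_ac)
  qed (simp add: E_def)
  have summ2: "summable (\<lambda>n. 2 * (norm (a n) * real n powr (- \<sigma>)))"
    using a \<open>\<sigma> > 1\<close> by (auto simp: dser_abs_conv_def intro: summable_mult)
  have E0: "E n j \<ge> 0" for n j
    by (simp add: E_def)
  have lim: "(\<lambda>j. E n j) \<longlonglongrightarrow> 0" for n
  proof (cases "n = 0")
    case False
    then have "(\<lambda>j. of_nat n powr (- (\<i> * of_real (\<tau> j))) - \<psi> n) \<longlonglongrightarrow> 0"
      using \<tau>[of n] by (simp add: LIM_zero)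
    then show ?thesis
      unfolding E_def by (intro tendsto_mult_right_zero tendsto_norm_zero)
  qed (simp add: E_def)
  have tann: "(\<lambda>j. \<Sum>n. E n j) \<longlonglongrightarrow> suminf (\<lambda>n. 0 :: real)"
    using tannerys_theorem[of E "\<lambda>_. 0" sequentially "\<lambda>n. 2 * (norm (a n) * real n powr (- \<sigma>))"]
      lim summ2 Ebound E0 by (simp add: case_prod_unfold)
  have summE: "summable (\<lambda>n. E n j)" for j
    using summ2 by (rule summable_comparison_test_ev[rotated]) (auto simp: E0 Ebound intro!: always_eventually)
  have bd: "norm (dser a (s + \<i> * of_real (\<tau> j)) - dser (\<lambda>n. a n * \<psi> n) s) \<le> (\<Sum>n. E n j)"
    if s: "Re s \<ge> \<sigma>" for s j
  proof -
    have "dser a (s + \<i> * of_real (\<tau> j)) - dser (\<lambda>n. a n * \<psi> n) s =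
       (\<Sum>n. a n * of_nat n powr (- (s + \<i> * of_real (\<tau> j))) - a n * \<psi> n * of_nat n powr (- s))"
      unfolding dser_def using s \<open>\<sigma> > 1\<close> a \<psi>
      by (intro suminf_diff dser_abs_conv_summable dser_abs_conv_twist) auto
    also have "\<dots> = (\<Sum>n. a n * of_nat n powr (- s) * (of_nat n powr (- (\<i> * of_real (\<tau> j))) - \<psi> n))"
      unfolding of_nat_powr_shift by (simp add: algebra_simps)
    also have "norm \<dots> \<le> (\<Sum>n. E n j)"
    proof (rule norm_suminf_le[OF _ summE])
      fix n
      have "real n powr (- Re s) \<le> real n powr (- \<sigma>)"
        using s by (cases "n = 0") (auto intro: powr_mono)
      then show "norm (a n * of_nat n powr (- s) * (of_nat n powr (- (\<i> * of_real (\<tau> j))) - \<psi> n)) \<le> E n j"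
        unfolding E_def norm_mult norm_of_nat_powr by (intro mult_right_mono mult_left_mono) auto
    qed
    finally show ?thesis .
  qed
  show ?thesis
  proof (rule uniform_limitI)
    fix e :: real assume "e > 0"
    have "eventually (\<lambda>j. (\<Sum>n. E n j) < e) sequentially"
      using tann \<open>e > 0\<close> by (intro order_tendstoD(2)[OF tann]) simp
    then show "\<forall>\<^sub>F j in sequentially. \<forall>s\<in>{s. Re s \<ge> \<sigma>}.
        dist (dser a (s + \<i> * of_real (\<tau> j))) (dser (\<lambda>n. a n * \<psi> n) s) < e"
      by eventually_elim (auto simp: dist_norm intro: le_less_trans[OF bd])
  qed
qed

lemma dser_twist_tendsto:
  assumes "dser_abs_conv a" "unimodular_multiplicative \<psi>" "Re s > 1"
    and "\<And>n. n > 0 \<Longrightarrow> (\<lambda>j. of_nat n powr (- (\<i> * of_real (\<tau> j)))) \<longlonglongrightarrow> \<psi> n"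
  shows "(\<lambda>j. dser a (s + \<i> * of_real (\<tau> j))) \<longlonglongrightarrow> dser (\<lambda>n. a n * \<psi> n) s"
  by (rule tendsto_uniform_limitI[OF dser_twist_uniform_limit[OF assms(1,2,3,4)]]) auto

lemma open_Re_strip: "open {s. A < Re s \<and> Re s < B}"
  by (intro open_Collect_conj open_halfspace_Re_gt open_halfspace_Re_lt)

text \<open>The twist is a locally uniform limit of vertical translates of
  \<open>dser a\<close>.\<close>

lemma dser_twist_holomorphic:
  assumes a: "dser_abs_conv a" and hol: "dser a holomorphic_on {s. Re s > 1}"
    and \<psi>: "unimodular_multiplicative \<psi>"
  shows "dser (\<lambda>n. a n * \<psi> n) holomorphic_on {s. Re s > 1}"
proof -
  obtain \<tau> where \<tau>: "\<And>n. n > 0 \<Longrightarrow> (\<lambda>j. of_nat n powr (- (\<i> * of_real (\<tau> j)))) \<longlonglongrightarrow> \<psi> n"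
    using unimodular_multiplicative_approx[OF \<psi>] by metis
  show ?thesis
  proof (rule holomorphic_uniform_sequence)
    show "open {s. Re s > 1}" by (rule open_halfspace_Re_gt)
    show "(\<lambda>s. dser a (s + \<i> * of_real (\<tau> j))) holomorphic_on {s. Re s > 1}" for j
      by (rule holomorphic_on_compose_gen[OF _ hol, unfolded o_def]) (auto intro!: holomorphic_intros)
    fix x assume x: "x \<in> {s. Re s > 1}"
    define d where "d = (Re x - 1) / 2"
    have sub: "cball x d \<subseteq> {s. Re s \<ge> (1 + Re x) / 2}"
    proof
      fix s assume "s \<in> cball x d"
      then have "Re x - Re s \<le> d"
        using abs_Re_le_cmod[of "x - s"] by (simp add: dist_norm)
      then show "s \<in> {s. Re s \<ge> (1 + Re x) / 2}"
        by (simp add: d_def field_simps)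
    qed
    show "\<exists>d>0. cball x d \<subseteq> {s. Re s > 1} \<and>
      uniform_limit (cball x d) (\<lambda>j s. dser a (s + \<i> * of_real (\<tau> j))) (dser (\<lambda>n. a n * \<psi> n)) sequentially"
    proof (intro exI[of _ d] conjI)
      show "d > 0" using x by (simp add: d_def)
      show "cball x d \<subseteq> {s. Re s > 1}" using sub x by (force simp: field_simps)
      have "(1 + Re x) / 2 > 1" using x by simp
      from uniform_limit_on_subset[OF dser_twist_uniform_limit[OF a \<psi> this \<tau>] sub]
      show "uniform_limit (cball x d) (\<lambda>j s. dser a (s + \<i> * of_real (\<tau> j))) (dser (\<lambda>n. a n * \<psi> n)) sequentially" .
    qed
  qed
qed

text \<open>
  Hurwitz applied to vertical translates. If the twist is constant on the strip, then translating
  back shows that the series itself takes the value \<open>v\<close> there.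
\<close>

lemma dser_twist_omits:
  assumes a: "dser_abs_conv a" and hol: "dser a holomorphic_on {s. Re s > 1}"
    and \<psi>: "unimodular_multiplicative \<psi>" and "A > 1"
    and omit: "\<And>s. A < Re s \<Longrightarrow> Re s < B \<Longrightarrow> dser a s \<noteq> v"
    and s0: "A < Re s0" "Re s0 < B"
  shows "dser (\<lambda>n. a n * \<psi> n) s0 \<noteq> v"
proof
  assume eq: "dser (\<lambda>n. a n * \<psi> n) s0 = v"
  obtain \<tau> where \<tau>: "\<And>n. n > 0 \<Longrightarrow> (\<lambda>j. of_nat n powr (- (\<i> * of_real (\<tau> j)))) \<longlonglongrightarrow> \<psi> n"
    using unimodular_multiplicative_approx[OF \<psi>] by metis
  define S where "S = {s. A < Re s \<and> Re s < B}"
  have sub: "S \<subseteq> {s. Re s > 1}" "S \<subseteq> {s. Re s \<ge> A}"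
    using \<open>A > 1\<close> by (auto simp: S_def)
  have "open S" unfolding S_def by (rule open_Re_strip)
  have "convex S"
    unfolding S_def Collect_conj_eq by (intro convex_Int convex_halfspace_Re_gt convex_halfspace_Re_lt)
  have ul: "uniform_limit {s. Re s \<ge> A} (\<lambda>j s. dser a (s + \<i> * of_real (\<tau> j))) (dser (\<lambda>n. a n * \<psi> n)) sequentially"
    by (rule dser_twist_uniform_limit[OF a \<psi> \<open>A > 1\<close> \<tau>])
  have "(\<lambda>s. dser (\<lambda>n. a n * \<psi> n) s - v) constant_on S"
  proof (rule ccontr)
    assume nonconst: "\<not> (\<lambda>s. dser (\<lambda>n. a n * \<psi> n) s - v) constant_on S"
    have "dser (\<lambda>n. a n * \<psi> n) s0 - v \<noteq> 0"
    proof (rule Hurwitz_no_zeros[OF \<open>open S\<close> convex_connected[OF \<open>convex S\<close>] _ _ _ nonconst])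
      show "(\<lambda>s. dser a (s + \<i> * of_real (\<tau> j)) - v) holomorphic_on S" for j
        using sub by (intro holomorphic_intros holomorphic_on_compose_gen[OF _ hol, unfolded o_def]) auto
      show "(\<lambda>s. dser (\<lambda>n. a n * \<psi> n) s - v) holomorphic_on S"
        using holomorphic_on_subset[OF dser_twist_holomorphic[OF a hol \<psi>] sub(1)]
        by (intro holomorphic_intros)
      show "uniform_limit K (\<lambda>j s. dser a (s + \<i> * of_real (\<tau> j)) - v) (\<lambda>s. dser (\<lambda>n. a n * \<psi> n) s - v) sequentially"
        if "K \<subseteq> S" for K
        using that sub(2) by (intro uniform_limit_minus uniform_limit_const uniform_limit_on_subset[OF ul]) auto
      show "dser a (s + \<i> * of_real (\<tau> j)) - v \<noteq> 0" if "s \<in> S" for s j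
        using that omit[of "s + \<i> * of_real (\<tau> j)"] by (simp add: S_def)
    qed (use s0 in \<open>simp add: S_def\<close>)
    then show False using eq by simp
  qed
  then have const: "dser (\<lambda>n. a n * \<psi> n) s = v" if "s \<in> S" for s
  proof -
    have "s0 \<in> S" using s0 by (simp add: S_def)
    with \<open>(\<lambda>s. dser (\<lambda>n. a n * \<psi> n) s - v) constant_on S\<close> that
    have "dser (\<lambda>n. a n * \<psi> n) s - v = dser (\<lambda>n. a n * \<psi> n) s0 - v"
      unfolding constant_on_def by metis
    then show ?thesis using eq by simp
  qed
  have "(\<lambda>j. dist (dser a s0) v) \<longlonglongrightarrow> 0"
  proof (rule LIMSEQ_I)
    fix e :: real assume "e > 0"
    \<comment> \<open>Uniformity in \<open>s\<close> is essential: the estimate for \<open>j\<close>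
      is used at \<open>s0 - \<i> * \<tau> j\<close>, a point that itself depends on
      \<open>j\<close>.\<close>
    from uniform_limitD[OF ul this]
    obtain j where j: "\<And>s. Re s \<ge> A \<Longrightarrow> dist (dser a (s + \<i> * of_real (\<tau> j))) (dser (\<lambda>n. a n * \<psi> n) s) < e"
      by (auto simp: eventually_sequentially)
    have "s0 - \<i> * of_real (\<tau> j) \<in> S" using s0 by (simp add: S_def)
    then have "dist (dser a s0) v < e"
      using j[of "s0 - \<i> * of_real (\<tau> j)"] const[of "s0 - \<i> * of_real (\<tau> j)"] s0 by simp
    then show "\<exists>no. \<forall>n\<ge>no. norm (dist (dser a s0) v - 0) < e" by simp
  qed
  then have "dser a s0 = v"
    by (simp add: LIMSEQ_const_iff)
  then show False using omit s0 by blast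
qed

section \<open>Coefficients at primes and Euler factors\<close>

text \<open>After multiplication by \<open>m powr \<sigma>\<close> the \<open>n\<close>-th term is
  \<open>a n\<close> times \<open>(m / n) powr \<sigma>\<close>, which tends to 0 for
  \<open>n > m\<close>. For \<open>\<sigma> \<ge> 2\<close> the terms are dominated by their values
  at 2, so Tannery's theorem applies.\<close>

lemma dser_leading_coeff:
  assumes a: "dser_abs_conv a" and "m > 0" and zero: "\<And>n. 0 < n \<Longrightarrow> n < m \<Longrightarrow> a n = 0"
  shows "((\<lambda>\<sigma>. of_real (real m powr \<sigma>) * dser a (of_real \<sigma>)) \<longlongrightarrow> a m) at_top"
proof -
  define b where "b n = (if n = m then a m else 0)" for n
  define f where "f n \<sigma> = a n * of_real ((real m / real n) powr \<sigma>)" for n and \<sigma> :: real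
  have f_eq: "of_real (real m powr \<sigma>) * (a n * of_nat n powr (- of_real \<sigma>)) = f n \<sigma>" for n \<sigma>
  proof (cases "n = 0")
    case False
    have "of_nat n powr (- complex_of_real \<sigma>) = of_real (real n powr (- \<sigma>))"
      by (subst powr_of_real[symmetric]) auto
    then show ?thesis
      using False by (simp add: f_def powr_divide powr_minus field_simps)
  qed (simp add: f_def)
  have M: "norm (f n \<sigma>) \<le> real m powr 2 * (norm (a n) * real n powr (- 2))" if "\<sigma> \<ge> 2" for n \<sigma>
  proof (cases "n = 0 \<or> n < m")
    case True
    then show ?thesis using zero[of n] by (cases "n = 0") (auto simp: f_def)
  next
    case False
    then have "(real m / real n) powr \<sigma> \<le> (real m / real n) powr 2"
      using that \<open>m > 0\<close> by (intro powr_mono') auto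
    then have "norm (a n) * (real m / real n) powr \<sigma> \<le> norm (a n) * (real m / real n) powr 2"
      by (intro mult_left_mono) auto
    moreover have "(real m / real n) powr 2 = real m powr 2 * real n powr (-2)"
      using False by (simp add: powr_divide powr_minus field_simps)
    ultimately show ?thesis by (simp add: f_def norm_mult mult_ac)
  qed
  have "summable (\<lambda>n. real m powr 2 * (norm (a n) * real n powr (- 2)))"
    using a by (auto simp: dser_abs_conv_def intro!: summable_mult)
  moreover have "(f n \<longlongrightarrow> b n) at_top" for n
  proof -
    consider "n = 0" | "0 < n" "n < m" | "n = m" | "n > m" by linarith
    then show ?thesis
    proof cases
      case 4
      have "((\<lambda>\<sigma>. (real m / real n) powr \<sigma>) \<longlongrightarrow> 0) at_top"
        using 4 \<open>m > 0\<close> by real_asymp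
      then have "((\<lambda>\<sigma>. a n * of_real ((real m / real n) powr \<sigma>)) \<longlongrightarrow> a n * of_real 0) at_top"
        by (intro tendsto_intros)
      then show ?thesis using 4 by (simp add: f_def[abs_def] b_def)
    qed (use \<open>m > 0\<close> zero in \<open>auto simp: f_def[abs_def] b_def\<close>)
  qed
  moreover have "eventually (\<lambda>(n, \<sigma>). norm (f n \<sigma>) \<le> real m powr 2 * (norm (a n) * real n powr (- 2)))
                   (at_top \<times>\<^sub>F at_top)"
    unfolding eventually_prod_filter
    by (rule exI[of _ "\<lambda>_. True"], rule exI[of _ "\<lambda>\<sigma>. \<sigma> \<ge> 2"]) (use M in auto)
  ultimately have "((\<lambda>\<sigma>. \<Sum>n. f n \<sigma>) \<longlongrightarrow> suminf b) at_top"
    using tannerys_theorem[of f b at_top "\<lambda>n. real m powr 2 * (norm (a n) * real n powr (- 2))"]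
    by simp
  moreover have "suminf b = a m"
    using suminf_finite[of "{m}" b] by (simp add: b_def)
  moreover have "eventually (\<lambda>\<sigma>. (\<Sum>n. f n \<sigma>) = of_real (real m powr \<sigma>) * dser a (of_real \<sigma>)) at_top"
    using eventually_gt_at_top[of 1]
  proof eventually_elim
    case (elim \<sigma>)
    show ?case
      unfolding dser_def f_eq[symmetric]
      by (rule suminf_mult, rule dser_abs_conv_summable[OF a]) (use elim in auto)
  qed
  ultimately show ?thesis
    by (simp cong: filterlim_cong)
qed

text \<open>This twist rotates \<open>p powr (- s)\<close> by \<open>u\<close> and fixes the
  corresponding powers of all other primes.\<close>

lemma unimodular_multiplicative_power_multiplicity:
  assumes "prime p" "norm u = 1"
  shows "unimodular_multiplicative (\<lambda>n. u ^ multiplicity p n)"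
  using assms unfolding unimodular_multiplicative_def
  by (auto simp: norm_power prime_elem_multiplicity_mult_distrib power_add)

lemma unimodular_multiplicative_mult:
  assumes "unimodular_multiplicative \<psi>" "unimodular_multiplicative \<psi>'"
  shows "unimodular_multiplicative (\<lambda>n. \<psi> n * \<psi>' n)"
  using assms unfolding unimodular_multiplicative_def by (simp add: norm_mult)

text \<open>The removable singularity is filled in, so that the limit can be composed with a
  function that may take the value 0.\<close>

lemma tendsto_exp_minus_1_over: "((\<lambda>z::complex. if z = 0 then 1 else (exp z - 1) / z) \<longlongrightarrow> 1) (nhds 0)"
proof -
  have "((\<lambda>z::complex. (exp z - 1) / z) \<longlongrightarrow> 1) (at 0)"
    using DERIV_exp[of "0::complex"] by (simp add: has_field_derivative_iff)
  then have "((\<lambda>z::complex. if z = 0 then 1 else (exp z - 1) / z) \<longlongrightarrow> 1) (at 0)"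
    by (rule Lim_transform_eventually) (auto simp: eventually_at_filter)
  then show ?thesis
    using tendsto_at_iff_tendsto_nhds[of "\<lambda>z::complex. if z = 0 then 1 else (exp z - 1) / z" 0] by simp
qed

text \<open>
  Twisting by \<open>(-1)\<^bsup>v\<^sub>p(n)\<^esup>\<close>, where \<open>v\<^sub>p\<close> is the \<open>p\<close>-adic valuation, isolates the terms with
  \<open>p dvd n\<close>: as \<open>\<sigma> \<rightarrow> \<infinity>\<close>, the difference between the series and its twist is asymptotic to
  \<open>2 a(p) p\<^bsup>-\<sigma>\<^esup>\<close>.
\<close>

lemma exp_dser_prime_coeff_eq:
  assumes a: "dser_abs_conv a" and b: "dser_abs_conv b"
    and exp_eq: "\<And>s. Re s > 1 \<Longrightarrow> exp (dser b s) = dser a s"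
    and "b 1 = 0" and p: "prime p"
  shows "a p = b p"
proof -
  define \<psi> :: "nat \<Rightarrow> complex" where "\<psi> n = (- 1) ^ multiplicity p n" for n
  have \<psi>: "unimodular_multiplicative \<psi>"
    unfolding \<psi>_def[abs_def] by (rule unimodular_multiplicative_power_multiplicity[OF p]) simp
  have p0: "p > 0" "p > 1" using p by (auto dest: prime_gt_0_nat prime_gt_1_nat)
  have \<psi>_less: "\<psi> n = 1" if "0 < n" "n < p" for n
    using that by (simp add: \<psi>_def not_dvd_imp_multiplicity_0 nat_dvd_not_less)
  have "multiplicity p p = 1"
    using p by (simp add: multiplicity_prime)
  then have \<psi>p: "\<psi> p = - 1" by (simp add: \<psi>_def)
  obtain \<tau> where \<tau>: "\<And>n. n > 0 \<Longrightarrow> (\<lambda>j. of_nat n powr (- (\<i> * of_real (\<tau> j)))) \<longlonglongrightarrow> \<psi> n"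
    using unimodular_multiplicative_approx[OF \<psi>] by metis
  \<comment> \<open>The relation between \<open>a\<close> and \<open>b\<close> holds for all
    vertical translates and passes to their limit, the twist.\<close>
  have exp_eq': "exp (dser (\<lambda>n. b n * \<psi> n) s) = dser (\<lambda>n. a n * \<psi> n) s" if s: "Re s > 1" for s
  proof -
    have "(\<lambda>j. exp (dser b (s + \<i> * of_real (\<tau> j)))) \<longlonglongrightarrow> exp (dser (\<lambda>n. b n * \<psi> n) s)"
      by (intro tendsto_exp dser_twist_tendsto b \<psi> s \<tau>)
    moreover have "(\<lambda>j. dser a (s + \<i> * of_real (\<tau> j))) \<longlonglongrightarrow> dser (\<lambda>n. a n * \<psi> n) s"
      by (intro dser_twist_tendsto a \<psi> s \<tau>)
    moreover have "exp (dser b (s + \<i> * of_real (\<tau> j))) = dser a (s + \<i> * of_real (\<tau> j))" for j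
      using s by (intro exp_eq) simp
    ultimately show ?thesis
      using LIMSEQ_unique by simp
  qed
  note a\<psi> = dser_abs_conv_twist[OF a \<psi>] and b\<psi> = dser_abs_conv_twist[OF b \<psi>]
  define D where "D f \<sigma> = dser (\<lambda>n. f n - f n * \<psi> n) (complex_of_real \<sigma>)" for f \<sigma>
  have D: "D f \<sigma> = dser f (of_real \<sigma>) - dser (\<lambda>n. f n * \<psi> n) (of_real \<sigma>)"
    if "dser_abs_conv f" "\<sigma> > 1" for f \<sigma>
    unfolding D_def using that by (intro dser_diff dser_abs_conv_twist \<psi>) auto
  have lim: "((\<lambda>\<sigma>. of_real (real p powr \<sigma>) * D f \<sigma>) \<longlongrightarrow> 2 * f p) at_top" if "dser_abs_conv f" for f
    using dser_leading_coeff[OF dser_abs_conv_diff[OF that dser_abs_conv_twist[OF that \<psi>]] p0(1)] \<psi>_less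
    by (simp add: D_def \<psi>p)
  have limB: "((\<lambda>\<sigma>. dser (\<lambda>n. b n * \<psi> n) (of_real \<sigma>)) \<longlongrightarrow> 0) at_top"
    using dser_leading_coeff[OF b\<psi>, of 1] \<open>b 1 = 0\<close> by simp
  have "((\<lambda>\<sigma>. D b \<sigma>) \<longlongrightarrow> 0) at_top"
    using dser_leading_coeff[OF dser_abs_conv_diff[OF b b\<psi>], of 1] \<open>b 1 = 0\<close> by (simp add: D_def)
  then have limE: "((\<lambda>\<sigma>. (\<lambda>z. if z = 0 then 1 else (exp z - 1) / z) (D b \<sigma>)) \<longlongrightarrow> 1) at_top"
    by (rule filterlim_compose[OF tendsto_exp_minus_1_over])
  \<comment> \<open>With \<open>x\<close> and \<open>y\<close> the values of \<open>dser b\<close>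
    and of its twist, \<open>exp x - exp y\<close> is the product of \<open>exp y\<close>,
    \<open>x - y\<close> and \<open>(exp (x - y) - 1) / (x - y)\<close>. Scaled by
    \<open>p powr \<sigma>\<close>, the product tends to \<open>2 * b p\<close>, whereas
    \<open>lim\<close> for \<open>a\<close> gives \<open>2 * a p\<close>.\<close>
  have "((\<lambda>\<sigma>. exp (dser (\<lambda>n. b n * \<psi> n) (of_real \<sigma>)) * (of_real (real p powr \<sigma>) * D b \<sigma>) *
            (\<lambda>z. if z = 0 then 1 else (exp z - 1) / z) (D b \<sigma>)) \<longlongrightarrow> exp 0 * (2 * b p) * 1) at_top"
    by (intro tendsto_mult tendsto_exp limB lim b limE)
  moreover have "eventually (\<lambda>\<sigma>. exp (dser (\<lambda>n. b n * \<psi> n) (of_real \<sigma>)) * (of_real (real p powr \<sigma>) * D b \<sigma>) *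
            (\<lambda>z. if z = 0 then 1 else (exp z - 1) / z) (D b \<sigma>) = of_real (real p powr \<sigma>) * D a \<sigma>) at_top"
    using eventually_gt_at_top[of 1]
  proof eventually_elim
    case (elim \<sigma>)
    have "exp y * (exp (x - y) - 1) = exp x - exp y" for x y :: complex
      by (simp add: right_diff_distrib flip: exp_add)
    then have "exp (dser (\<lambda>n. b n * \<psi> n) (of_real \<sigma>)) * (exp (D b \<sigma>) - 1) = D a \<sigma>"
      unfolding D[OF a elim] D[OF b elim] using exp_eq[of "of_real \<sigma>"] exp_eq'[of "of_real \<sigma>"] elim
      by (metis Re_complex_of_real)
    from this[symmetric] show ?case by simp
  qed
  ultimately have "((\<lambda>\<sigma>. of_real (real p powr \<sigma>) * D a \<sigma>) \<longlongrightarrow> exp 0 * (2 * b p) * 1) at_top"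
    by (rule Lim_transform_eventually)
  then show ?thesis
    using tendsto_unique[OF trivial_limit_at_top_linorder lim[OF a]] by force
qed

text \<open>Allows the double series over \<open>p\<close> and \<open>k\<close> for the logarithm to
  be treated as a single Dirichlet series over \<open>n = p ^ k\<close>.\<close>

definition prime_power_supported :: "(nat \<Rightarrow> complex) \<Rightarrow> bool" where
  "prime_power_supported b \<longleftrightarrow> (\<forall>n. b n \<noteq> 0 \<longrightarrow> (\<exists>p k. prime p \<and> k \<ge> 1 \<and> n = p ^ k))"

lemma prime_power_supported_1: "prime_power_supported b \<Longrightarrow> b 1 = 0"
  unfolding prime_power_supported_def
  by (metis One_nat_def nat_power_eq_Suc_0_iff not_one_le_zero not_prime_1)

text \<open>This is the power series \<open>\<phi>\<close> at \<open>p\<close>. Its constant term is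
  \<open>b 1\<close>, which is 0 for coefficients supported on prime powers.\<close>

definition euler_factor :: "(nat \<Rightarrow> complex) \<Rightarrow> nat \<Rightarrow> complex \<Rightarrow> complex" where
  "euler_factor b p z = (\<Sum>k. b (p ^ k) * z ^ k)"

lemma of_nat_power_powr:
  assumes "n > 0"
  shows "of_nat (n ^ k) powr s = (of_nat n powr s :: complex) ^ k"
  using assms by (induction k) (simp_all add: powr_times_real)

lemma dser_prime_powers:
  assumes p: "prime p" and supp: "\<And>n. b n \<noteq> 0 \<Longrightarrow> \<exists>k. n = p ^ k"
  shows "dser b s = euler_factor b p (of_nat p powr (- s))"
proof -
  have "strict_mono (\<lambda>k. p ^ k)"
    using p prime_gt_1_nat by (auto intro!: strict_monoI)
  moreover have "b n * of_nat n powr (- s) = 0" if "n \<notin> range (\<lambda>k. p ^ k)" for n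
    using that supp[of n] by auto
  ultimately have "(\<Sum>k. b (p ^ k) * of_nat (p ^ k) powr (- s)) = dser b s"
    unfolding dser_def by (rule suminf_mono_reindex)
  then show ?thesis
    using p by (simp only: euler_factor_def of_nat_power_powr prime_gt_0_nat)
qed

lemma summable_euler_factor:
  assumes b: "dser_abs_conv b" and p: "prime p" and "Re s > 1"
  shows "summable (\<lambda>k. b (p ^ k) * (of_nat p powr (- s)) ^ k)"
proof -
  have "inj (\<lambda>k. p ^ k)"
    using p prime_gt_1_nat by (auto intro!: strict_mono_imp_inj_on strict_monoI)
  then have "summable ((\<lambda>n. norm (b n * of_nat n powr (- s))) \<circ> (\<lambda>k. p ^ k))"
    using dser_abs_conv_summable_norm[OF b \<open>Re s > 1\<close>] by (intro summable_reindex) auto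
  then have "summable (\<lambda>k. b (p ^ k) * of_nat (p ^ k) powr (- s))"
    unfolding o_def by (rule summable_norm_cancel)
  then show ?thesis
    unfolding euler_factor_def of_nat_power_powr[OF prime_gt_0_nat[OF p]] by simp
qed

text \<open>The twist changes \<open>b n\<close> only if \<open>p\<close> divides \<open>n\<close>,
  and then \<open>n\<close> must be a power of \<open>p\<close> for \<open>b n\<close> to be
  nonzero. So only the Euler factor at \<open>p\<close> changes, and its argument is rotated by
  \<open>u\<close>.\<close>

lemma dser_twist_prime:
  assumes b: "dser_abs_conv b" and pp: "prime_power_supported b" and p: "prime p"
    and u: "norm u = 1" and s: "Re s > 1"
  shows "dser (\<lambda>n. b n * u ^ multiplicity p n) s =
           dser b s + euler_factor b p (u * of_nat p powr (- s)) - euler_factor b p (of_nat p powr (- s))"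
proof -
  define c where "c n = b n * u ^ multiplicity p n - b n" for n
  have mult: "multiplicity p (p ^ k) = k" for k
    using p by (simp add: multiplicity_same_power)
  have b': "dser_abs_conv (\<lambda>n. b n * u ^ multiplicity p n)"
    by (intro dser_abs_conv_twist b unimodular_multiplicative_power_multiplicity p u)
  have "dser c s = euler_factor c p (of_nat p powr (- s))"
  proof (rule dser_prime_powers[OF p])
    fix n assume "c n \<noteq> 0"
    then have "b n \<noteq> 0"
      by (auto simp: c_def)
    have "multiplicity p n \<noteq> 0"
    proof
      assume "multiplicity p n = 0"
      then show False using \<open>c n \<noteq> 0\<close> by (simp add: c_def)
    qed
    from \<open>b n \<noteq> 0\<close> obtain q k where qk: "prime q" "n = q ^ k"
      using pp by (auto simp: prime_power_supported_def)
    have "p = q"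
      using \<open>multiplicity p n \<noteq> 0\<close> qk p by (metis multiplicity_distinct_prime_power)
    then show "\<exists>k. n = p ^ k" using qk by auto
  qed
  also have "\<dots> = euler_factor b p (u * of_nat p powr (- s)) - euler_factor b p (of_nat p powr (- s))"
  proof -
    have "summable (\<lambda>k. b (p ^ k) * (u * of_nat p powr (- s)) ^ k)"
      using summable_euler_factor[OF b' p s] by (simp add: mult mult_ac power_mult_distrib)
    then show ?thesis
      unfolding euler_factor_def using summable_euler_factor[OF b p s]
      by (subst suminf_diff) (simp_all add: c_def mult algebra_simps power_mult_distrib)
  qed
  also have "dser c s = dser (\<lambda>n. b n * u ^ multiplicity p n) s - dser b s"
    unfolding c_def by (rule dser_diff[OF b' b s])
  finally show ?thesis by (simp add: algebra_simps)
qed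

text \<open>Two applications of the twist at one prime; the first leaves the Euler factor at
  \<open>q\<close> unchanged.\<close>

lemma dser_twist_two_primes:
  assumes b: "dser_abs_conv b" and pp: "prime_power_supported b"
    and p: "prime p" and q: "prime q" and "p \<noteq> q"
    and u: "norm u = 1" and w: "norm w = 1" and s: "Re s > 1"
  shows "dser (\<lambda>n. b n * (u ^ multiplicity p n * w ^ multiplicity q n)) s =
           dser b s + euler_factor b p (u * of_nat p powr (- s)) - euler_factor b p (of_nat p powr (- s))
                    + euler_factor b q (w * of_nat q powr (- s)) - euler_factor b q (of_nat q powr (- s))"
proof -
  define c where "c n = b n * u ^ multiplicity p n" for n
  have c: "dser_abs_conv c"
    unfolding c_def[abs_def] by (intro dser_abs_conv_twist b unimodular_multiplicative_power_multiplicity p u)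
  have ppc: "prime_power_supported c"
    using pp by (auto simp: prime_power_supported_def c_def)
  have "c (q ^ k) = b (q ^ k)" for k
    using p q \<open>p \<noteq> q\<close> by (simp add: c_def multiplicity_distinct_prime_power)
  then have "euler_factor c q = euler_factor b q"
    by (simp add: euler_factor_def[abs_def])
  moreover have "dser (\<lambda>n. b n * (u ^ multiplicity p n * w ^ multiplicity q n)) s
                   = dser (\<lambda>n. c n * w ^ multiplicity q n) s"
    by (simp add: c_def mult.assoc)
  moreover have "dser c s = dser (\<lambda>n. b n * u ^ multiplicity p n) s"
    by (simp add: c_def[abs_def])
  ultimately show ?thesis
    using dser_twist_prime[OF c ppc q w s] dser_twist_prime[OF b pp p u s]
    by simp
qed

section \<open>Values of Euler factors on discs and circles\<close>

text \<open>To be used with \<open>c k = d (p ^ k)\<close> and \<open>R = p powr \<theta>\<close>.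
  The numerical constants below are uniform in \<open>p\<close> as long as \<open>norm z * R\<close>
  is at most 3/4.\<close>

context
  fixes c :: "nat \<Rightarrow> complex" and C R :: real
  assumes c0: "c 0 = 0" and bound: "\<And>k. norm (c k) \<le> C * R ^ k" and "R > 0"
begin

lemma power_series_coeff_bound: "norm (c k * z ^ k) \<le> C * (norm z * R) ^ k"
  using mult_right_mono[OF bound[of k], of "norm z ^ k"]
  by (simp add: norm_mult norm_power power_mult_distrib mult_ac)

lemma power_series_summable:
  assumes "norm z < 1 / R"
  shows "summable (\<lambda>k. c k * z ^ k)"
proof (rule summable_comparison_test')
  have "norm (norm z * R) < 1"
    using assms \<open>R > 0\<close> by (simp add: field_simps abs_mult)
  then show "summable (\<lambda>k. C * (norm z * R) ^ k)"
    by (intro summable_mult summable_geometric)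
  show "norm (c k * z ^ k) \<le> C * (norm z * R) ^ k" if "k \<ge> 0" for k
    by (rule power_series_coeff_bound)
qed

lemma power_series_has_derivative:
  assumes "norm z < 1 / R"
  shows "((\<lambda>z. \<Sum>k. c k * z ^ k) has_field_derivative (\<Sum>k. diffs c k * z ^ k)) (at z)"
  by (rule termdiffs_strong'[OF power_series_summable assms])

lemma power_series_holomorphic: "(\<lambda>z. \<Sum>k. c k * z ^ k) holomorphic_on ball 0 (1 / R)"
  by (subst holomorphic_on_open) (auto intro!: exI power_series_has_derivative)

text \<open>The constant term vanishes and the rest is at most a geometric series with ratio
  \<open>y \<le> 3 / 4\<close>, where \<open>1 / (1 - y) \<le> 4\<close>.\<close>

lemma power_series_norm_le:
  assumes "norm z * R \<le> 3 / 4"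
  shows "norm (\<Sum>k. c k * z ^ k) \<le> 4 * C * (norm z * R)"
proof -
  define y where "y = norm z * R"
  have y: "0 \<le> y" "y \<le> 3 / 4" using assms \<open>R > 0\<close> by (auto simp: y_def)
  have "C \<ge> 0" using bound[of 0] c0 by simp
  have "norm z < 1 / R" using y \<open>R > 0\<close> by (simp add: y_def field_simps)
  then have "(\<Sum>k. c k * z ^ k) = (\<Sum>k. c (Suc k) * z ^ Suc k)"
    using suminf_split_head[OF power_series_summable] c0 by simp
  also have "norm \<dots> \<le> (\<Sum>k. C * y * y ^ k)"
  proof (rule norm_suminf_le)
    show "norm (c (Suc k) * z ^ Suc k) \<le> C * y * y ^ k" for k
      using power_series_coeff_bound[of "Suc k" z] by (simp add: y_def mult_ac)
    show "summable (\<lambda>k. C * y * y ^ k)"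
      using y by (intro summable_mult summable_geometric) auto
  qed
  also have "\<dots> = C * y * (1 / (1 - y))"
    using y by (subst suminf_mult) (auto simp: suminf_geometric intro!: summable_geometric)
  also have "\<dots> \<le> C * y * 4"
    using y \<open>C \<ge> 0\<close> by (intro mult_left_mono) (auto simp: field_simps)
  finally show ?thesis by (simp add: y_def mult_ac)
qed

text \<open>Without its constant term \<open>c 1\<close>, the derivative is bounded by a multiple of
  the sum of \<open>(k + 2) * y ^ k\<close>, which is
  \<open>1 / (1 - y)\<^sup>2 + 1 / (1 - y)\<close> and hence at most 16 + 4.\<close>

lemma power_series_deriv_norm_diff_le:
  assumes "norm z * R \<le> 3 / 4"
  shows "norm ((\<Sum>k. diffs c k * z ^ k) - c 1) \<le> 20 * C * R * (norm z * R)"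
proof -
  define y where "y = norm z * R"
  have y: "0 \<le> y" "y \<le> 3 / 4" using assms \<open>R > 0\<close> by (auto simp: y_def)
  have "C \<ge> 0" using bound[of 0] c0 by simp
  have "norm z < 1 / R" using y \<open>R > 0\<close> by (simp add: y_def field_simps)
  then have "summable (\<lambda>k. diffs c k * z ^ k)"
    by (rule termdiff_converges) (rule power_series_summable)
  then have "(\<Sum>k. diffs c k * z ^ k) - c 1 = (\<Sum>k. diffs c (Suc k) * z ^ Suc k)"
    using suminf_split_head[of "\<lambda>k. diffs c k * z ^ k"] by (simp add: diffs_def del: of_nat_Suc power_Suc)
  also have "norm \<dots> \<le> (\<Sum>k. C * R * y * (real (Suc k) * y ^ k + y ^ k))"
  proof (rule norm_suminf_le)
    fix k
    have "norm (diffs c (Suc k) * z ^ Suc k) = real (Suc (Suc k)) * norm z ^ Suc k * norm (c (Suc (Suc k)))"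
      by (simp add: diffs_def norm_mult norm_power mult_ac del: of_nat_Suc)
    also have "\<dots> \<le> real (Suc (Suc k)) * norm z ^ Suc k * (C * R ^ Suc (Suc k))"
      by (intro mult_left_mono bound) auto
    also have "\<dots> = C * R * y * (real (Suc k) * y ^ k + y ^ k)"
      by (simp add: y_def power_mult_distrib algebra_simps)
    finally show "norm (diffs c (Suc k) * z ^ Suc k) \<le> C * R * y * (real (Suc k) * y ^ k + y ^ k)" .
  next
    show "summable (\<lambda>k. C * R * y * (real (Suc k) * y ^ k + y ^ k))"
      using y geometric_deriv_sums[of y] by (intro summable_mult summable_add summable_geometric sums_summable) auto
  qed
  also have "\<dots> = C * R * y * (1 / (1 - y)\<^sup>2 + 1 / (1 - y))"
    using y by (intro sums_unique[symmetric] sums_mult sums_add geometric_deriv_sums geometric_sums) auto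
  also have "\<dots> \<le> C * R * y * 20"
  proof (intro mult_left_mono)
    have 4: "1 / (1 - y) \<le> 4" using y by (simp add: field_simps)
    then have "(1 / (1 - y)) ^ 2 \<le> 4 ^ 2"
      using y by (intro power_mono) auto
    then show "1 / (1 - y)\<^sup>2 + 1 / (1 - y) \<le> 20"
      using 4 by (simp add: power_divide)
  qed (use y \<open>C \<ge> 0\<close> \<open>R > 0\<close> in auto)
  finally show ?thesis by (simp add: y_def mult_ac)
qed

end

text \<open>The open sets \<open>X\<close> and \<open>- (X \<union> Y)\<close> are disjoint and
  cover \<open>W\<close>, and \<open>x\<close> lies in the first.\<close>

lemma connected_subset_open_part:
  assumes "connected W" "open X" "closed (X \<union> Y)" "W \<inter> Y = {}" "x \<in> W" "x \<in> X \<union> Y"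
  shows "W \<subseteq> X"
proof -
  have "X \<inter> - (X \<union> Y) \<inter> W = {}" by blast
  moreover have "W \<subseteq> X \<union> - (X \<union> Y)" using assms(4) by blast
  ultimately have "X \<inter> W = {} \<or> - (X \<union> Y) \<inter> W = {}"
    by (rule connectedD[OF assms(1,2) open_Compl[OF assms(3)]])
  then show ?thesis using assms(4-6) by blast
qed

text \<open>
  Fix \<open>V = f z1 + h z2\<close>. If the curve \<open>V - h\<close> over the circle of radius \<open>r'\<close> avoided the image under
  \<open>f\<close> of the circle of radius \<open>r\<close>, it would stay inside the image of the open disc of radius \<open>r\<close>
  (which is open, with boundary contained in the image of the circle); the bound on \<open>f\<close> is too
  small for that, by Cauchy's inequality for \<open>h\<close>.
\<close>

lemma sum_on_circles_attained:
  assumes f: "f holomorphic_on ball 0 R1" and nonconst: "\<not> f constant_on ball 0 R1" and r: "0 < r" "r < R1"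
    and h: "h holomorphic_on ball 0 R2" and r': "0 < r'" "r' < R2"
    and M: "\<And>z. norm z \<le> r \<Longrightarrow> norm (f z) \<le> M" and large: "M < norm (deriv h 0) * r'"
    and z1: "norm z1 \<le> r" and z2: "norm (z2 :: complex) = r'"
  obtains z1' z2' where "norm z1' = r" "norm z2' = r'" "f z1' + h z2' = f z1 + h z2"
proof -
  define V where "V = f z1 + h z2"
  define W where "W = (\<lambda>u. V - h u) ` sphere 0 r'"
  have sub: "ball 0 r \<subseteq> ball 0 R1" "cball 0 r \<subseteq> ball 0 R1" "ball 0 r' \<subseteq> ball (0::complex) R2"
    "cball 0 r' \<subseteq> ball (0::complex) R2" "sphere 0 r' \<subseteq> ball (0::complex) R2"
    using r r' by auto
  have conth: "continuous_on (ball 0 R2) h"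
    by (rule holomorphic_on_imp_continuous_on[OF h])
  have "W \<inter> f ` sphere 0 r \<noteq> {}"
  proof
    assume disj: "W \<inter> f ` sphere 0 r = {}"
    have "connected W"
      unfolding W_def
      by (intro connected_continuous_image connected_sphere continuous_intros continuous_on_subset[OF conth] sub) auto
    have op: "open (f ` ball 0 r)"
      by (rule open_mapping_thm[OF f _ _ _ _ nonconst]) (use sub in auto)
    have "compact (f ` cball 0 r)"
      by (intro compact_continuous_image compact_cball
            continuous_on_subset[OF holomorphic_on_imp_continuous_on[OF f]] sub)
    then have cl: "closed (f ` cball 0 r)"
      by (rule compact_imp_closed)
    have "cball 0 r = ball 0 r \<union> sphere (0::complex) r" by auto
    then have img: "f ` cball 0 r = f ` ball 0 r \<union> f ` sphere 0 r"
      by (simp only: image_Un)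
    \<comment> \<open>A point where the curve meets the image of the closed disc: at
      \<open>z2\<close> it passes through \<open>f z1\<close>.\<close>
    have "f z1 \<in> W"
      unfolding W_def using z2 by (auto intro!: image_eqI[of _ _ z2] simp: V_def)
    moreover have "f z1 \<in> f ` cball 0 r" using z1 by auto
    ultimately have "W \<subseteq> f ` ball 0 r"
      using connected_subset_open_part[OF \<open>connected W\<close> op] cl disj unfolding img by metis
    then have W: "norm x \<le> M" if "x \<in> W" for x
    proof -
      obtain z where "z \<in> ball 0 r" "x = f z"
        using \<open>W \<subseteq> f ` ball 0 r\<close> \<open>x \<in> W\<close> by blast
      then show ?thesis using M[of z] by simp
    qed
    have "norm ((deriv ^^ 1) (\<lambda>u. V - h u) 0) \<le> fact 1 * M / r' ^ 1"
    proof (rule Cauchy_inequality[OF _ _ r'(1)])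
      show "(\<lambda>u. V - h u) holomorphic_on ball 0 r'"
        by (intro holomorphic_intros holomorphic_on_subset[OF h] sub)
      show "continuous_on (cball 0 r') (\<lambda>u. V - h u)"
        by (intro continuous_intros continuous_on_subset[OF conth] sub)
      show "norm (V - h x) \<le> M" if "norm (0 - x) = r'" for x
        using that by (intro W) (auto simp: W_def)
    qed
    moreover have "h field_differentiable at 0"
      using h r' by (intro holomorphic_on_imp_differentiable_at[of _ "ball 0 R2"]) auto
    then have "deriv (\<lambda>u. V - h u) 0 = - deriv h 0"
      by (subst deriv_diff) auto
    ultimately have "norm (deriv h 0) \<le> M / r'" by simp
    then show False using large r' by (simp add: field_simps)
  qed
  then obtain z1' z2' where "z2' \<in> sphere 0 r'" "z1' \<in> sphere 0 r" "V - h z2' = f z1'"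
    unfolding W_def by blast
  then show thesis
    using that[of z1' z2'] by (simp add: V_def algebra_simps)
qed

text \<open>To be used with \<open>f\<close> the Euler factor at \<open>p\<close> and
  \<open>e s = p powr (- s)\<close>. A local inverse \<open>g\<close> of \<open>f\<close> near
  \<open>e \<rho>\<close> gives the solution \<open>g (H s)\<close>; its quotient by
  \<open>e s\<close> cannot have modulus greater than 1 everywhere off the line, as it equals 1 at
  \<open>\<rho>\<close>.\<close>

lemma local_solution_leaves_disc:
  assumes f: "f holomorphic_on S" "open S" and "deriv f (e \<rho>) \<noteq> 0"
    and "\<epsilon> > 0" and H: "H holomorphic_on ball \<rho> \<epsilon>"
    and e: "e holomorphic_on ball \<rho> \<epsilon>" "\<And>s. e s \<noteq> 0" "e \<rho> \<in> S"
    and eq: "f (e \<rho>) = H \<rho>"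
  obtains s z where "s \<in> ball \<rho> \<epsilon>" "Re s \<noteq> Re \<rho>" "z \<in> S" "norm z \<le> norm (e s)" "f z = H s"
proof (rule ccontr)
  note attained = that
  assume "\<not> thesis"
  then have out: "norm z > norm (e s)" if "s \<in> ball \<rho> \<epsilon>" "Re s \<noteq> Re \<rho>" "z \<in> S" "f z = H s" for s z
    using attained[of s z] that by linarith
  obtain r where r: "r > 0" "ball (e \<rho>) r \<subseteq> S" "open (f ` ball (e \<rho>) r)" "inj_on f (ball (e \<rho>) r)"
    using has_complex_derivative_locally_invertible[OF f(1) e(3) f(2) assms(3)] by metis
  obtain g where g: "g holomorphic_on f ` ball (e \<rho>) r" "\<And>z. z \<in> ball (e \<rho>) r \<Longrightarrow> g (f z) = z"
    using holomorphic_has_inverse[OF holomorphic_on_subset[OF f(1) r(2)] open_ball r(4)] by metis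
  have "open (ball \<rho> \<epsilon> \<inter> H -` (f ` ball (e \<rho>) r))"
    by (intro continuous_open_preimage holomorphic_on_imp_continuous_on H open_ball r(3))
  moreover have "\<rho> \<in> ball \<rho> \<epsilon> \<inter> H -` (f ` ball (e \<rho>) r)"
    using \<open>\<epsilon> > 0\<close> r(1) eq[symmetric] by auto
  ultimately obtain \<epsilon>' where \<epsilon>': "\<epsilon>' > 0" "ball \<rho> \<epsilon>' \<subseteq> ball \<rho> \<epsilon> \<inter> H -` (f ` ball (e \<rho>) r)"
    unfolding open_contains_ball by blast
  define Q where "Q s = g (H s) / e s" for s
  have holQ: "Q holomorphic_on ball \<rho> \<epsilon>'"
    unfolding Q_def[abs_def] using \<epsilon>'(2) e(2)
    by (intro holomorphic_intros holomorphic_on_compose_gen[OF _ g(1), unfolded o_def]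
          holomorphic_on_subset[OF H] holomorphic_on_subset[OF e(1)]) auto
  have off: "norm (Q s) > 1" if s: "s \<in> ball \<rho> \<epsilon>'" "Re s \<noteq> Re \<rho>" for s
  proof -
    obtain z where z: "z \<in> ball (e \<rho>) r" "H s = f z"
      using \<epsilon>'(2) s(1) by blast
    have "norm z > norm (e s)"
      using \<epsilon>'(2) s z r(2) by (intro out) auto
    then show ?thesis
      using z g(2) e(2)[of s] by (simp add: Q_def norm_divide field_simps)
  qed
  \<comment> \<open>On the line itself the weak inequality follows by continuity, approaching
    \<open>s\<close> from the right through points off the line.\<close>
  have Q1: "norm (Q s) \<ge> 1" if s: "s \<in> ball \<rho> \<epsilon>'" for s
  proof (cases "Re s = Re \<rho>")
    case True
    have "isCont Q s"
      using holomorphic_on_imp_continuous_on[OF holQ] s by (simp add: continuous_on_eq_continuous_at)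
    then have "((\<lambda>t. norm (Q (s + of_real t))) \<longlongrightarrow> norm (Q (s + of_real 0))) (at_right 0)"
      by (intro tendsto_norm isCont_tendsto_compose[of _ Q] tendsto_intros) auto
    moreover have "eventually (\<lambda>t. norm (Q (s + of_real t)) \<ge> 1) (at_right 0)"
    proof -
      have "((\<lambda>t::real. s + of_real t) \<longlongrightarrow> s + of_real 0) (at_right 0)"
        by (intro tendsto_intros)
      then have "eventually (\<lambda>t::real. s + of_real t \<in> ball \<rho> \<epsilon>') (at_right 0)"
        using s by (intro topological_tendstoD) auto
      then show ?thesis
        using eventually_at_right_less[of 0]
        by eventually_elim (use True off in \<open>auto intro!: less_imp_le\<close>)
    qed
    ultimately show ?thesis
      using tendsto_lowerbound[of "\<lambda>t. norm (Q (s + of_real t))"] by (simp add: trivial_limit_at_right_real)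
  qed (use off[OF s] in auto)
  have Q\<rho>: "Q \<rho> = 1"
    using g(2)[of "e \<rho>"] r(1) eq e(2)[of \<rho>] by (simp add: Q_def)
  have Q0: "Q s \<noteq> 0" if "s \<in> ball \<rho> \<epsilon>'" for s
    using Q1[OF that] by auto
  \<comment> \<open>The modulus of \<open>1 / Q\<close> is maximal at the centre. Constancy would
    give \<open>Q\<close> modulus 1 off the line as well.\<close>
  have "(\<lambda>s. 1 / Q s) constant_on ball \<rho> \<epsilon>'"
  proof (rule maximum_modulus_principle)
    show "(\<lambda>s. 1 / Q s) holomorphic_on ball \<rho> \<epsilon>'"
      using Q0 by (intro holomorphic_intros holQ) auto
    show "norm (1 / Q z) \<le> norm (1 / Q \<rho>)" if "z \<in> ball \<rho> \<epsilon>'" for z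
      using Q1[OF that] Q0[OF that] by (simp add: Q\<rho> norm_divide field_simps)
  qed (use \<epsilon>'(1) in auto)
  moreover have s: "\<rho> + of_real (\<epsilon>' / 2) \<in> ball \<rho> \<epsilon>'" "\<rho> \<in> ball \<rho> \<epsilon>'"
    using \<epsilon>'(1) by (auto simp: dist_norm)
  ultimately have "1 / Q (\<rho> + of_real (\<epsilon>' / 2)) = 1 / Q \<rho>"
    unfolding constant_on_def by metis
  then have "norm (Q (\<rho> + of_real (\<epsilon>' / 2))) = 1"
    using Q\<rho> by simp
  then show False
    using off[OF s(1)] \<epsilon>'(1) by simp
qed

section \<open>Values on neighbouring vertical lines\<close>

text \<open>The worst case is \<open>1 / sqrt 2\<close> at \<open>p = 2\<close>; the bound 3/4 is
  the threshold of the power series estimates.\<close>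

lemma prime_powr_le_three_quarters:
  assumes "prime (p::nat)" "x \<le> - 1 / 2"
  shows "real p powr x \<le> 3 / 4"
proof -
  have "real p \<ge> 2" using prime_ge_2_nat[OF assms(1)] by simp
  then have "real p powr x \<le> real p powr (- (1 / 2))"
    using assms(2) by (intro powr_mono) auto
  also have "\<dots> \<le> 2 powr (- (1 / 2))"
    using \<open>real p \<ge> 2\<close> by (intro powr_mono2') auto
  also have "\<dots> = 1 / sqrt 2"
    by (simp add: powr_minus powr_half_sqrt field_simps)
  also have "\<dots> \<le> 3 / 4"
  proof -
    have "4 / 3 \<le> sqrt 2" by (rule real_le_rsqrt) (simp add: power2_eq_square)
    then show ?thesis by (simp add: field_simps)
  qed
  finally show ?thesis .
qed

lemma constant_on_open_imp_deriv_0: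
  assumes "f constant_on S" "open S" "z \<in> S"
  shows "deriv f z = 0"
proof -
  obtain y where y: "\<And>x. x \<in> S \<Longrightarrow> f x = y"
    using assms(1) by (auto simp: constant_on_def)
  have "(f has_field_derivative 0) (at z)"
    by (rule has_field_derivative_transform_within_open[OF DERIV_const[of y] assms(2,3)]) (simp add: y)
  then show ?thesis by (rule DERIV_imp_deriv)
qed

text \<open>
  If the value of \<open>dser d\<close> at \<open>\<rho>\<close> is not attained on neighbouring vertical lines, no twist attains it
  there either. For a large prime \<open>p\<close>, solve \<open>\<phi>\<^sub>p(z(s)) = dser d \<rho> - (dser d s - \<phi>\<^sub>p(p\<^bsup>-s\<^esup>))\<close> near \<open>\<rho>\<close>,
  where \<open>\<phi>\<^sub>p = euler_factor d p\<close> and \<open>z(\<rho>) = p\<^bsup>-\<rho>\<^esup>\<close>. At some \<open>s\<close> off the line, \<open>z(s)\<close> lies in the disc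
  of radius \<open>p\<^bsup>-\<sigma>\<^esup>\<close>; moving the arguments at \<open>p\<close> and at a fixed smaller prime \<open>q\<close> to the circles
  of radii \<open>p\<^bsup>-\<sigma>\<^esup>\<close> and \<open>q\<^bsup>-\<sigma>\<^esup>\<close> gives a twist at \<open>p\<close> and \<open>q\<close> with the forbidden value.
\<close>

lemma dser_value_not_isolated:
  assumes d: "dser_abs_conv d" and pp: "prime_power_supported d"
    and hol: "dser d holomorphic_on {s. Re s > 1}"
    and \<theta>: "\<theta> < 1 / 2"
    and bound: "\<And>p k. prime p \<Longrightarrow> k \<ge> 1 \<Longrightarrow> norm (d (p ^ k)) \<le> C * real p powr (real k * \<theta>)"
    and large: "\<And>K N. \<exists>p\<ge>N. prime p \<and> norm (d p) > K * real p powr (2 * \<theta> - 1)"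
    and \<rho>: "Re \<rho> > 1" and "\<delta> > 0"
  obtains s where "Re s > 1" "0 < \<bar>Re s - Re \<rho>\<bar>" "\<bar>Re s - Re \<rho>\<bar> < \<delta>" "dser d s = dser d \<rho>"
proof (rule ccontr)
  note attained = that
  assume "\<not> thesis"
  define v where "v = dser d \<rho>"
  \<comment> \<open>Decreasing \<open>\<delta>\<close> keeps the strips on both sides of the line
    inside the half-plane of absolute convergence.\<close>
  define \<delta>' where "\<delta>' = min \<delta> ((Re \<rho> - 1) / 2)"
  have \<delta>': "\<delta>' > 0" "\<delta>' \<le> \<delta>" "Re \<rho> - \<delta>' > 1"
    using \<rho> \<open>\<delta> > 0\<close> by (auto simp: \<delta>'_def min_def field_simps)
  have omit: "dser d s \<noteq> v" if "Re s > 1" "0 < \<bar>Re s - Re \<rho>\<bar>" "\<bar>Re s - Re \<rho>\<bar> < \<delta>'" for s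
    using attained[of s] that \<open>\<not> thesis\<close> \<delta>' by (auto simp: v_def)
  \<comment> \<open>The punctured strip consists of two open strips, one on each side of the line,
    to which Hurwitz's theorem is applied separately.\<close>
  have omit_twist: "dser (\<lambda>n. d n * \<psi> n) s \<noteq> v"
    if \<psi>: "unimodular_multiplicative \<psi>" and s: "0 < \<bar>Re s - Re \<rho>\<bar>" "\<bar>Re s - Re \<rho>\<bar> < \<delta>'" for \<psi> s
  proof (cases "Re s < Re \<rho>")
    case True
    show ?thesis
    proof (rule dser_twist_omits[OF d hol \<psi> \<delta>'(3), of "Re \<rho>"])
      show "dser d s \<noteq> v" if "Re \<rho> - \<delta>' < Re s" "Re s < Re \<rho>" for s
        using that \<delta>' by (intro omit) auto
    qed (use True s in auto)
  next
    case False
    show ?thesis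
    proof (rule dser_twist_omits[OF d hol \<psi> \<rho>, of "Re \<rho> + \<delta>'"])
      show "dser d s \<noteq> v" if "Re \<rho> < Re s" "Re s < Re \<rho> + \<delta>'" for s
        using that \<delta>' \<rho> by (intro omit) auto
    qed (use False s in auto)
  qed
  have Re_ball: "\<bar>Re s - Re \<rho>\<bar> < \<delta>'" "Re s > 1" if "s \<in> ball \<rho> \<delta>'" for s
    using abs_Re_le_cmod[of "s - \<rho>"] that \<delta>'(3) by (auto simp: dist_norm norm_minus_commute)

  have C0: "C \<ge> 0"
  proof -
    have "0 \<le> C * real 2 powr (real 1 * \<theta>)"
      by (rule order_trans[OF norm_ge_zero bound]) auto
    then show ?thesis by (simp add: zero_le_mult_iff)
  qed
  have d1: "d 1 = 0" by (rule prime_power_supported_1[OF pp])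
  have coeff: "norm (d (p ^ k)) \<le> C * (real p powr \<theta>) ^ k" if "prime p" for p k
    using bound[OF that, of k] d1 C0 prime_gt_0_nat[OF that] by (cases "k = 0") (auto simp: powr_power)
  have c0: "d (p ^ 0) = 0" for p using d1 by simp
  have Rpos: "real p powr \<theta> > 0" if "prime p" for p
    using prime_gt_0_nat[OF that] by simp
  note ps = c0 coeff Rpos
  have \<phi>_def: "euler_factor d p = (\<lambda>z. \<Sum>k. d (p ^ k) * z ^ k)" for p
    by (simp add: fun_eq_iff euler_factor_def)
  have \<phi>_hol: "euler_factor d p holomorphic_on ball 0 (1 / real p powr \<theta>)" if "prime p" for p
    unfolding \<phi>_def by (rule power_series_holomorphic[where C = C]) (use ps that in auto)
  have \<phi>_deriv: "deriv (euler_factor d p) z = (\<Sum>k. diffs (\<lambda>k. d (p ^ k)) k * z ^ k)"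
    if "prime p" "norm z < 1 / real p powr \<theta>" for p z
    unfolding \<phi>_def
    by (intro DERIV_imp_deriv power_series_has_derivative[where C = C and R = "real p powr \<theta>"])
       (use ps that in auto)
  have \<phi>_deriv0: "deriv (euler_factor d p) 0 = d p" if "prime p" for p
    using \<phi>_deriv[OF that, of 0] Rpos[OF that] by (simp add: diffs_def)
  \<comment> \<open>Arguments of modulus at most \<open>1 / p\<close> are the only ones needed. As
    \<open>\<theta> - 1 < - 1 / 2\<close>, they lie where the power series estimates hold.\<close>
  have radius: "x * real p powr \<theta> \<le> real p powr (\<theta> - 1)" "x * real p powr \<theta> \<le> 3 / 4"
    "x < 1 / real p powr \<theta>"
    if "prime p" "x \<le> real p powr (- 1)" for p x
  proof -
    have "x * real p powr \<theta> \<le> real p powr (- 1) * real p powr \<theta>"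
      using that by (intro mult_right_mono) auto
    also have "\<dots> = real p powr (\<theta> - 1)"
      unfolding powr_add[symmetric] by (simp add: add.commute)
    finally show 1: "x * real p powr \<theta> \<le> real p powr (\<theta> - 1)" .
    also have "\<dots> \<le> 3 / 4"
      using \<theta> by (intro prime_powr_le_three_quarters that) auto
    finally show "x * real p powr \<theta> \<le> 3 / 4" .
    then show "x < 1 / real p powr \<theta>"
      using Rpos[OF that(1)] by (simp add: field_simps)
  qed
  have \<phi>_bound: "norm (euler_factor d p z) \<le> 4 * C * real p powr (- (1 / 2))"
    if "prime p" "norm z \<le> real p powr (- 1)" for p z
  proof -
    have "norm (euler_factor d p z) \<le> 4 * C * (norm z * real p powr \<theta>)"
      unfolding \<phi>_def by (rule power_series_norm_le) (use ps that radius in auto)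
    also have "norm z * real p powr \<theta> \<le> real p powr (\<theta> - 1)"
      by (rule radius[OF that])
    also have "\<dots> \<le> real p powr (- (1 / 2))"
      using \<theta> prime_ge_1_nat[OF that(1)] by (intro powr_mono) auto
    finally show ?thesis using C0 by (simp add: mult_left_mono)
  qed
  have powr_Re: "real p powr (- Re s) \<le> real p powr (- 1)" if "prime p" "Re s > 1" for p s
    using prime_ge_1_nat[OF that(1)] that(2) by (intro powr_mono) auto

  obtain q where q: "prime q" "norm (d q) > 0"
    using large[of 0 0] by auto
  \<comment> \<open>A lower bound, valid throughout the ball around \<open>\<rho>\<close>, for the
    derivative at 0 of the Euler factor at \<open>q\<close> times the radius
    \<open>q powr (- Re s)\<close>. It is fixed before \<open>p\<close> is chosen.\<close>
  define \<kappa> where "\<kappa> = norm (d q) * real q powr (- (Re \<rho> + \<delta>'))"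
  have "\<kappa> > 0" using q prime_gt_0_nat[of q] by (simp add: \<kappa>_def)
  have "((\<lambda>n. 4 * C * real n powr (- (1 / 2))) \<longlongrightarrow> 0) at_top"
    by real_asymp
  then have "eventually (\<lambda>n. 4 * C * real n powr (- (1 / 2)) < \<kappa>) at_top"
    using \<open>\<kappa> > 0\<close> by (rule order_tendstoD)
  then obtain N where N: "\<And>n. n \<ge> N \<Longrightarrow> 4 * C * real n powr (- (1 / 2)) < \<kappa>"
    by (auto simp: eventually_at_top_linorder)
  \<comment> \<open>The three demands on \<open>p\<close> make its Euler factor smaller than
    \<open>\<kappa>\<close>, make \<open>p\<close> different from \<open>q\<close>, and make the
    linear coefficient dominate the derivative.\<close>
  obtain p where p: "p \<ge> max N (Suc q)" "prime p" "norm (d p) > 20 * C * real p powr (2 * \<theta> - 1)"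
    using large by blast
  have "p \<noteq> q" using p(1) by auto
  define e where "e s = of_nat p powr (- s)" for s :: complex
  have norm_e: "norm (e s) = real p powr (- Re s)" for s
    by (simp add: e_def norm_of_nat_powr)
  have e_radius: "norm (e s) \<le> real p powr (- 1)" if "Re s > 1" for s
    unfolding norm_e using p(2) that by (rule powr_Re)
  have e_hol: "e holomorphic_on A" for A
    unfolding e_def[abs_def] using prime_gt_0_nat[OF p(2)] by (intro holomorphic_intros) auto
  have e_nz: "e s \<noteq> 0" for s
    using prime_gt_0_nat[OF p(2)] by (simp add: e_def)
  have e_ball: "e s \<in> ball 0 (1 / real p powr \<theta>)" if "Re s > 1" for s
    using radius(3)[OF p(2) e_radius[OF that]] by simp
  have deriv_nz: "deriv (euler_factor d p) (e \<rho>) \<noteq> 0"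
  proof
    assume "deriv (euler_factor d p) (e \<rho>) = 0"
    then have "norm (d p) = norm (deriv (euler_factor d p) (e \<rho>) - d (p ^ 1))"
      by simp
    also have "\<dots> \<le> 20 * C * real p powr \<theta> * (norm (e \<rho>) * real p powr \<theta>)"
      using e_ball[OF \<rho>] unfolding \<phi>_deriv[OF p(2), of "e \<rho>", simplified]
      by (subst \<phi>_deriv[OF p(2)], simp, intro power_series_deriv_norm_diff_le)
         (use ps p(2) radius(2)[OF p(2) e_radius[OF \<rho>]] in auto)
    also have "\<dots> \<le> 20 * C * real p powr \<theta> * real p powr (\<theta> - 1)"
      using C0 radius(1)[OF p(2) e_radius[OF \<rho>]] by (intro mult_left_mono) auto
    also have "\<dots> = 20 * C * real p powr (2 * \<theta> - 1)"
      by (simp add: mult.assoc flip: powr_add)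
    finally show False using p(3) by simp
  qed
  then have nonconst: "\<not> euler_factor d p constant_on ball 0 (1 / real p powr \<theta>)"
    using constant_on_open_imp_deriv_0 e_ball[OF \<rho>] by blast
  \<comment> \<open>The Euler factor at \<open>p\<close> is removed from \<open>dser d\<close>; a
    solution \<open>z\<close> of \<open>euler_factor d p z = H s\<close> is an argument that, put in
    place of \<open>p powr (- s)\<close>, restores the value \<open>v\<close>.\<close>
  define H where "H s = v - dser d s + euler_factor d p (e s)" for s
  have H_hol: "H holomorphic_on ball \<rho> \<delta>'"
    unfolding H_def[abs_def]
    using Re_ball e_ball
    by (intro holomorphic_intros holomorphic_on_subset[OF hol]
          holomorphic_on_compose_gen[OF e_hol \<phi>_hol[OF p(2)], unfolded o_def]) auto
  have "euler_factor d p (e \<rho>) = H \<rho>"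
    by (simp add: H_def v_def)
  then obtain s z where s: "s \<in> ball \<rho> \<delta>'" "Re s \<noteq> Re \<rho>" "norm z \<le> norm (e s)" "euler_factor d p z = H s"
    using local_solution_leaves_disc[OF \<phi>_hol[OF p(2)] open_ball deriv_nz \<delta>'(1) H_hol e_hol e_nz e_ball[OF \<rho>]]
    by metis
  note Re_s = Re_ball[OF s(1)]
  define x where "x = of_nat q powr (- s)"
  have norm_x: "norm x = real q powr (- Re s)"
    by (simp add: x_def norm_of_nat_powr)
  have pos: "real p powr (- Re s) > 0" "real q powr (- Re s) > 0"
    using prime_gt_0_nat[OF p(2)] prime_gt_0_nat[OF q(1)] by auto
  \<comment> \<open>A twist only rotates arguments, but \<open>z\<close> may lie strictly inside its
    circle. The Euler factor at \<open>q\<close> compensates for moving \<open>z\<close> to the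
    circle.\<close>
  obtain z' x' where z': "norm z' = real p powr (- Re s)" and x': "norm x' = real q powr (- Re s)"
    and sum_eq: "euler_factor d p z' + euler_factor d q x' = euler_factor d p z + euler_factor d q x"
  proof (rule sum_on_circles_attained[OF \<phi>_hol[OF p(2)] nonconst pos(1) _ \<phi>_hol[OF q(1)] pos(2)])
    show "real p powr (- Re s) < 1 / real p powr \<theta>"
      by (rule radius(3)[OF p(2) powr_Re[OF p(2) Re_s(2)]])
    show "real q powr (- Re s) < 1 / real q powr \<theta>"
      by (rule radius(3)[OF q(1) powr_Re[OF q(1) Re_s(2)]])
    show "norm (euler_factor d p z) \<le> 4 * C * real p powr (- (1 / 2))"
      if "norm z \<le> real p powr (- Re s)" for z
      using that powr_Re[OF p(2) Re_s(2)] by (intro \<phi>_bound p(2)) auto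
    have "4 * C * real p powr (- (1 / 2)) < \<kappa>" using p(1) by (intro N) auto
    also have "\<kappa> \<le> norm (d q) * real q powr (- Re s)"
      unfolding \<kappa>_def using Re_s prime_ge_1_nat[OF q(1)] by (intro mult_left_mono powr_mono) auto
    finally show "4 * C * real p powr (- (1 / 2)) < norm (deriv (euler_factor d q) 0) * real q powr (- Re s)"
      by (simp add: \<phi>_deriv0[OF q(1)])
    show "norm z \<le> real p powr (- Re s)" using s(3) by (simp add: norm_e)
    show "norm x = real q powr (- Re s)" by (rule norm_x)
  qed
  define u w where "u = z' / e s" and "w = x' / x"
  have "x \<noteq> 0" using norm_x pos(2) by auto
  have u: "norm u = 1" "u * of_nat p powr (- s) = z'"
    using z' pos(1) e_nz[of s] by (auto simp: u_def norm_divide norm_e simp flip: e_def)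
  have w: "norm w = 1" "w * of_nat q powr (- s) = x'"
    using x' pos(2) \<open>x \<noteq> 0\<close> norm_x by (auto simp: w_def norm_divide simp flip: x_def)
  have "dser (\<lambda>n. d n * (u ^ multiplicity p n * w ^ multiplicity q n)) s =
          dser d s + euler_factor d p z' - euler_factor d p (e s) + euler_factor d q x' - euler_factor d q x"
    using dser_twist_two_primes[OF d pp p(2) q(1) \<open>p \<noteq> q\<close> u(1) w(1) Re_s(2)]
    unfolding u(2) w(2) by (simp add: e_def x_def)
  also have "\<dots> = v"
    using sum_eq s(4) by (simp add: H_def algebra_simps)
  finally have "dser (\<lambda>n. d n * (u ^ multiplicity p n * w ^ multiplicity q n)) s = v" .
  moreover have "unimodular_multiplicative (\<lambda>n. u ^ multiplicity p n * w ^ multiplicity q n)"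
    by (intro unimodular_multiplicative_mult unimodular_multiplicative_power_multiplicity p(2) q(1) u w)
  ultimately show False
    using omit_twist[of _ s] Re_s(1) s(2) by auto
qed

section \<open>Linear combinations of orthogonal functions\<close>

lemma dirichlet_series_for_imp_dser:
  assumes "dirichlet_series_for a F"
  shows "dser_abs_conv a" and "Re s > 1 \<Longrightarrow> F s = dser a s"
proof -
  have summ: "(\<lambda>n. norm (a n * of_nat n powr (- s))) summable_on UNIV" if "Re s > 1" for s
  proof -
    have "(\<lambda>n. norm (a n * of_nat n powr (- s))) summable_on {1..}"
      using assms that by (simp add: dirichlet_series_for_def)
    then show ?thesis
      by (subst summable_on_cong_neutral[of "{1..}"]) (auto simp: not_le)
  qed
  show conv: "dser_abs_conv a"
    unfolding dser_abs_conv_def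
  proof (intro allI impI)
    fix \<sigma> :: real assume "\<sigma> > 1"
    then show "summable (\<lambda>n. norm (a n) * real n powr (- \<sigma>))"
      using summable_on_imp_summable[OF summ[of "of_real \<sigma>"]] by (simp add: norm_mult norm_of_nat_powr)
  qed
  show "F s = dser a s" if s: "Re s > 1"
  proof -
    have "F s = (\<Sum>\<^sub>\<infinity>n\<in>{1..}. a n * of_nat n powr (- s))"
      using assms s by (simp add: dirichlet_series_for_def)
    also have "\<dots> = (\<Sum>\<^sub>\<infinity>n. a n * of_nat n powr (- s))"
      by (rule infsum_cong_neutral) (auto simp: not_le)
    also have "\<dots> = dser a s"
      unfolding dser_def using dser_abs_conv_summable_norm[OF conv s] dser_abs_conv_summable[OF conv s]
      by (intro infsumI norm_summable_imp_has_sum summable_sums)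
    finally show ?thesis .
  qed
qed

text \<open>Reindexes sums over pairs \<open>(p, k)\<close> as sums over prime powers.\<close>

lemma bij_betw_prime_powers:
  "bij_betw (\<lambda>(p, k). p ^ k) ({p. prime p} \<times> {1..}) {n::nat. \<exists>p k. prime p \<and> k \<ge> 1 \<and> n = p ^ k}"
  unfolding bij_betw_def
proof
  show "inj_on (\<lambda>(p, k). p ^ k) ({p::nat. prime p} \<times> {1..})"
    by (auto simp: inj_on_def prime_power_inj'')
  show "(\<lambda>(p, k). p ^ k) ` ({p. prime p} \<times> {1..}) = {n::nat. \<exists>p k. prime p \<and> k \<ge> 1 \<and> n = p ^ k}"
    by (simp add: image_def Bex_def conj_assoc)
qed

text \<open>Absolute convergence allows the iterated sum over \<open>p\<close> and \<open>k\<close>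
  to be rearranged into one Dirichlet series. The normalised branch of the logarithm makes that
  series holomorphic.\<close>

lemma condition_II_imp_dser:
  assumes "condition_II F"
  obtains B C \<theta> where "prime_power_supported B" "dser_abs_conv B" "dser B holomorphic_on {s. Re s > 1}"
    "\<And>s. Re s > 1 \<Longrightarrow> exp (dser B s) = F s"
    "\<theta> < 1 / 2" "\<And>p k. prime p \<Longrightarrow> k \<ge> 1 \<Longrightarrow> norm (B (p ^ k)) \<le> C * real p powr (real k * \<theta>)"
proof -
  obtain G b where G: "log_branch F G"
    and series: "\<forall>s. Re s > 1 \<longrightarrow>
           (\<lambda>(p, k). norm (b (p ^ k) * of_nat p powr (- (of_nat k * s))))
              summable_on ({p. prime p} \<times> {1..}) \<and>
           G s = (\<Sum>\<^sub>\<infinity>p\<in>{p. prime p}. \<Sum>\<^sub>\<infinity>k\<in>{1..}.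
                       b (p ^ k) * of_nat p powr (- (of_nat k * s)))"
    and "\<exists>\<theta> C :: real. \<theta> < 1 / 2 \<and>
           (\<forall>p k. prime p \<longrightarrow> k \<ge> 1 \<longrightarrow>
              norm (b (p ^ k) :: complex) \<le> C * real p powr (real k * \<theta>))"
    using assms unfolding condition_II_def by blast
  then obtain \<theta> C :: real where \<theta>: "\<theta> < 1 / 2"
    and bound: "\<And>p k. prime p \<Longrightarrow> k \<ge> 1 \<Longrightarrow> norm (b (p ^ k)) \<le> C * real p powr (real k * \<theta>)"
    by blast
  have summ: "(\<lambda>(p, k). norm (b (p ^ k) * of_nat p powr (- (of_nat k * s))))
              summable_on ({p. prime p} \<times> {1..})"
    and G_eq: "G s = (\<Sum>\<^sub>\<infinity>p\<in>{p. prime p}. \<Sum>\<^sub>\<infinity>k\<in>{1..}.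
                       b (p ^ k) * of_nat p powr (- (of_nat k * s)))" if "Re s > 1" for s
    using series that by blast+
  define PP where "PP = {n::nat. \<exists>p k. prime p \<and> k \<ge> 1 \<and> n = p ^ k}"
  \<comment> \<open>The values of \<open>b\<close> outside the prime powers are arbitrary, so they
    are replaced by 0.\<close>
  define B where "B n = (if n \<in> PP then b n else 0)" for n
  have term_eq: "b (p ^ k) * of_nat p powr (- (of_nat k * s)) = B (p ^ k) * of_nat (p ^ k) powr (- s)"
    if "prime p" "k \<ge> 1" for p k s
  proof -
    have "of_nat p powr (- (of_nat k * s)) = (of_nat p powr (- s) :: complex) ^ k"
      using prime_gt_0_nat[OF that(1)] by (subst powr_power) auto
    also have "\<dots> = of_nat (p ^ k) powr (- s)"
      using of_nat_power_powr[OF prime_gt_0_nat[OF that(1)]] by simp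
    finally show ?thesis using that by (auto simp: B_def PP_def)
  qed
  have summ': "(\<lambda>n. norm (B n * of_nat n powr (- s))) summable_on UNIV" if "Re s > 1" for s
  proof -
    have "(\<lambda>x. norm (B (case x of (p, k) \<Rightarrow> p ^ k) * of_nat (case x of (p, k) \<Rightarrow> p ^ k) powr (- s)))
            summable_on ({p. prime p} \<times> {1..})"
      using summ[OF that] by (rule summable_on_cong[THEN iffD1, rotated]) (auto simp: term_eq)
    then have "(\<lambda>n. norm (B n * of_nat n powr (- s))) summable_on PP"
      unfolding PP_def
      by (rule summable_on_reindex_bij_betw[OF bij_betw_prime_powers,
            where f = "\<lambda>n. norm (B n * of_nat n powr (- s))", THEN iffD1])
    then show ?thesis
      by (subst summable_on_cong_neutral[of PP]) (auto simp: B_def)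
  qed
  have conv: "dser_abs_conv B"
    unfolding dser_abs_conv_def
  proof (intro allI impI)
    fix \<sigma> :: real assume "\<sigma> > 1"
    then show "summable (\<lambda>n. norm (B n) * real n powr (- \<sigma>))"
      using summable_on_imp_summable[OF summ'[of "of_real \<sigma>"]] by (simp add: norm_mult norm_of_nat_powr)
  qed
  have G_dser: "G s = dser B s" if s: "Re s > 1" for s
  proof -
    have "(\<lambda>(p, k). b (p ^ k) * of_nat p powr (- (of_nat k * s))) summable_on ({p. prime p} \<times> {1..})"
      using summ[OF s] unfolding case_prod_unfold by (rule abs_summable_summable)
    from infsum_Sigma_banach[OF this]
    have "G s = (\<Sum>\<^sub>\<infinity>(p, k)\<in>{p. prime p} \<times> {1..}. b (p ^ k) * of_nat p powr (- (of_nat k * s)))"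
      using G_eq[OF s] by simp
    also have "\<dots> = (\<Sum>\<^sub>\<infinity>x\<in>{p. prime p} \<times> {1..}.
        B (case x of (p, k) \<Rightarrow> p ^ k) * of_nat (case x of (p, k) \<Rightarrow> p ^ k) powr (- s))"
      by (rule infsum_cong) (auto simp: term_eq)
    also have "\<dots> = (\<Sum>\<^sub>\<infinity>n\<in>PP. B n * of_nat n powr (- s))"
      unfolding PP_def by (rule infsum_reindex_bij_betw[OF bij_betw_prime_powers])
    also have "\<dots> = (\<Sum>\<^sub>\<infinity>n. B n * of_nat n powr (- s))"
      by (rule infsum_cong_neutral) (auto simp: B_def)
    also have "\<dots> = dser B s"
      unfolding dser_def using dser_abs_conv_summable_norm[OF conv s] dser_abs_conv_summable[OF conv s]
      by (intro infsumI norm_summable_imp_has_sum summable_sums)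
    finally show ?thesis .
  qed
  show thesis
  proof
    show "prime_power_supported B"
      by (auto simp: prime_power_supported_def B_def PP_def)
    show "dser_abs_conv B" by (rule conv)
    have "G holomorphic_on {s. Re s > 1}"
      using G by (simp add: log_branch_def)
    then show "dser B holomorphic_on {s. Re s > 1}"
      by (rule holomorphic_transform) (use G_dser in auto)
    show "exp (dser B s) = F s" if "Re s > 1" for s
      using G that unfolding G_dser[OF that, symmetric] by (simp add: log_branch_def)
    show "norm (B (p ^ k)) \<le> C * real p powr (real k * \<theta>)" if "prime p" "k \<ge> 1" for p k
      using bound[OF that] that by (auto simp: B_def PP_def)
  qed (rule \<theta>)
qed

text \<open>Expanding the square shows that the sum of \<open>|a 0 p - a 1 p|\<^sup>2 / p\<close>
  over \<open>p \<le> x\<close> is asymptotic to \<open>(m 0 0 + m 1 1) * ln (ln x)\<close>, since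
  the mixed sums are of smaller order. If the differences were at most
  \<open>K * p powr \<eta>\<close> for all large primes, the sum would stay bounded, because
  \<open>2 * \<eta> - 1 < - 1\<close>.\<close>

lemma orthogonal_coeff_diff_large:
  assumes o: "\<And>i j. i \<in> {0, 1::nat} \<Longrightarrow> j \<in> {0, 1} \<Longrightarrow>
      (\<lambda>x :: real. (\<Sum>p | prime p \<and> real p \<le> x. a i p * cnj (a j p) / of_nat p)
                - of_real (m i j) * of_real (ln (ln x)))
             \<in> o[at_top](\<lambda>x. of_real (ln (ln x)) :: complex)"
    and m: "m 0 0 > 0" "m 1 1 > 0" "m 0 1 = 0" "m 1 0 = (0::real)"
    and \<eta>: "\<eta> < 0"
  shows "\<exists>p\<ge>N. prime p \<and> norm (a 0 p - a 1 p) > K * real p powr \<eta>"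
proof (rule ccontr)
  assume "\<not> ?thesis"
  then have small: "norm (a 0 p - a 1 p) \<le> K * real p powr \<eta>" if "prime p" "p \<ge> N" for p
    using that by (auto simp: not_less)
  define T where "T x = (\<Sum>p | prime p \<and> real p \<le> x. (norm (a 0 p - a 1 p))\<^sup>2 / real p)" for x
  define S where "S i j x = (\<Sum>p | prime p \<and> real p \<le> x. a i p * cnj (a j p) / of_nat p)" for i j x
  have fin: "finite {p. prime p \<and> real p \<le> x}" for x
    by (rule finite_subset[of _ "{..nat \<lfloor>x\<rfloor>}"]) (auto simp: le_nat_floor)
  have fin': "finite {p. prime p \<and> real p \<le> x \<and> p \<ge> N}" for x
    by (rule finite_subset[OF _ fin[of x]]) auto
  have T_eq: "of_real (T x) = S 0 0 x - S 0 1 x - S 1 0 x + S 1 1 x" for x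
  proof -
    have "complex_of_real ((norm (a 0 p - a 1 p))\<^sup>2 / real p) =
       a 0 p * cnj (a 0 p) / of_nat p - a 0 p * cnj (a 1 p) / of_nat p
       - a 1 p * cnj (a 0 p) / of_nat p + a 1 p * cnj (a 1 p) / of_nat p" for p
    proof -
      have "complex_of_real ((norm (a 0 p - a 1 p))\<^sup>2) = (a 0 p - a 1 p) * cnj (a 0 p - a 1 p)"
        by (rule complex_norm_square)
      also have "\<dots> = a 0 p * cnj (a 0 p) - a 0 p * cnj (a 1 p) - a 1 p * cnj (a 0 p) + a 1 p * cnj (a 1 p)"
        by (simp add: algebra_simps)
      finally show ?thesis
        unfolding of_real_divide by (simp only: diff_divide_distrib add_divide_distrib of_real_of_nat_eq)
    qed
    then show ?thesis
      unfolding T_def S_def of_real_sum sum_subtractf[symmetric] sum.distrib[symmetric] by simp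
  qed
  have "(\<lambda>x. (S 0 0 x - of_real (m 0 0) * of_real (ln (ln x)))
           - (S 0 1 x - of_real (m 0 1) * of_real (ln (ln x)))
           - (S 1 0 x - of_real (m 1 0) * of_real (ln (ln x)))
           + (S 1 1 x - of_real (m 1 1) * of_real (ln (ln x))))
        \<in> o[at_top](\<lambda>x. of_real (ln (ln x)) :: complex)"
    unfolding S_def by (intro sum_in_smallo o) auto
  then have "(\<lambda>x. complex_of_real (T x - (m 0 0 + m 1 1) * ln (ln x)))
        \<in> o[at_top](\<lambda>x. of_real (ln (ln x)))"
    using m(3,4) by (simp add: T_eq algebra_simps)
  then have small1: "(\<lambda>x. T x - (m 0 0 + m 1 1) * ln (ln x)) \<in> o[at_top](\<lambda>x. ln (ln x))"
    by (simp only: landau_o.small.of_real_iff)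
  define h where "h n = K\<^sup>2 * real n powr (2 * \<eta> - 1)" for n
  have summ: "summable h"
    unfolding h_def using \<eta> by (intro summable_mult) (simp add: summable_real_powr_iff)
  define c where "c = (\<Sum>p<N. (norm (a 0 p - a 1 p))\<^sup>2 / real p)"
  have T_bound: "norm (T x) \<le> c + suminf h" for x
  proof -
    have "T x \<le> (\<Sum>p\<in>{..<N} \<union> {p. prime p \<and> real p \<le> x \<and> p \<ge> N}. (norm (a 0 p - a 1 p))\<^sup>2 / real p)"
      unfolding T_def using fin'[of x] by (intro sum_mono2) auto
    also have "\<dots> = c + (\<Sum>p | prime p \<and> real p \<le> x \<and> p \<ge> N. (norm (a 0 p - a 1 p))\<^sup>2 / real p)"
      unfolding c_def using fin'[of x] by (intro sum.union_disjoint) auto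
    also have "(\<Sum>p | prime p \<and> real p \<le> x \<and> p \<ge> N. (norm (a 0 p - a 1 p))\<^sup>2 / real p)
                 \<le> (\<Sum>p | prime p \<and> real p \<le> x \<and> p \<ge> N. h p)"
    proof (rule sum_mono)
      fix p assume "p \<in> {p. prime p \<and> real p \<le> x \<and> p \<ge> N}"
      then have p: "prime p" "p \<ge> N" by auto
      have "(norm (a 0 p - a 1 p))\<^sup>2 \<le> (K * real p powr \<eta>)\<^sup>2"
        using small[OF p] by (intro power_mono) auto
      also have "\<dots> = K\<^sup>2 * real p powr (2 * \<eta>)"
        using prime_gt_0_nat[OF p(1)] by (simp add: power_mult_distrib powr_power)
      finally have "(norm (a 0 p - a 1 p))\<^sup>2 / real p \<le> K\<^sup>2 * real p powr (2 * \<eta>) / real p"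
        by (intro divide_right_mono) auto
      also have "\<dots> = h p"
        using prime_gt_0_nat[OF p(1)] by (simp add: h_def powr_diff)
      finally show "(norm (a 0 p - a 1 p))\<^sup>2 / real p \<le> h p" .
    qed
    also have "\<dots> \<le> suminf h"
      using fin'[of x] by (intro sum_le_suminf summ) (auto simp: h_def)
    finally have "T x \<le> c + suminf h" by simp
    moreover have "T x \<ge> 0" unfolding T_def by (intro sum_nonneg) auto
    ultimately show ?thesis by simp
  qed
  have "T \<in> O[at_top](\<lambda>_. 1)"
    using T_bound by (intro bigoI[of _ "c + suminf h"]) auto
  also have "(\<lambda>_. 1) \<in> o[at_top](\<lambda>x::real. ln (ln x))"
    by real_asymp
  finally have "T \<in> o[at_top](\<lambda>x. ln (ln x))" .
  from sum_in_smallo(2)[OF this small1]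
  have "(\<lambda>x. (m 0 0 + m 1 1) * ln (ln x)) \<in> o[at_top](\<lambda>x. ln (ln x))"
    by simp
  \<comment> \<open>The factor \<open>m 0 0 + m 1 1\<close> is positive and can be cancelled. A
    function that is little-o of itself is eventually 0.\<close>
  then have "(\<lambda>x::real. ln (ln x)) \<in> o[at_top](\<lambda>x. ln (ln x))"
    using m(1,2) by (subst (asm) landau_o.small.cmult_in_iff) auto
  then have "eventually (\<lambda>x::real. ln (ln x) = 0) at_top"
    by (simp add: landau_o.small_refl_iff)
  moreover have "eventually (\<lambda>x::real. ln (ln x) > 0) at_top"
    by real_asymp
  ultimately have "eventually (\<lambda>x::real. False) at_top"
    by eventually_elim simp
  then show False by simp
qed

theorem theorem4:
  fixes F\<^sub>1 F\<^sub>2 :: "complex \<Rightarrow> complex" and c\<^sub>1 c\<^sub>2 :: complex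
  assumes "condition_I F\<^sub>1" and "condition_II F\<^sub>1"
    and "condition_I F\<^sub>2" and "condition_II F\<^sub>2"
    and "orthogonal_functions [F\<^sub>1, F\<^sub>2]"
    and "c\<^sub>1 \<noteq> 0" and "c\<^sub>2 \<noteq> 0"
  shows "\<not> (\<exists>\<beta>\<^sub>0 > 1. isolated_zero_line (\<lambda>s. c\<^sub>1 * F\<^sub>1 s + c\<^sub>2 * F\<^sub>2 s) \<beta>\<^sub>0)"
proof
  assume "\<exists>\<beta>\<^sub>0 > 1. isolated_zero_line (\<lambda>s. c\<^sub>1 * F\<^sub>1 s + c\<^sub>2 * F\<^sub>2 s) \<beta>\<^sub>0"
  then obtain \<rho> \<delta> where \<rho>: "Re \<rho> > 1" "c\<^sub>1 * F\<^sub>1 \<rho> + c\<^sub>2 * F\<^sub>2 \<rho> = 0" and "\<delta> > 0"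
    and isolated: "\<And>s. c\<^sub>1 * F\<^sub>1 s + c\<^sub>2 * F\<^sub>2 s = 0 \<Longrightarrow> 0 < \<bar>Re s - Re \<rho>\<bar> \<Longrightarrow> \<bar>Re s - Re \<rho>\<bar> < \<delta> \<Longrightarrow> False"
    unfolding isolated_zero_line_def by blast
  obtain B1 C1 \<theta>1 where B1: "prime_power_supported B1" "dser_abs_conv B1" "dser B1 holomorphic_on {s. Re s > 1}"
    "\<And>s. Re s > 1 \<Longrightarrow> exp (dser B1 s) = F\<^sub>1 s" "\<theta>1 < 1 / 2"
    "\<And>p k. prime p \<Longrightarrow> k \<ge> 1 \<Longrightarrow> norm (B1 (p ^ k)) \<le> C1 * real p powr (real k * \<theta>1)"
    using condition_II_imp_dser[OF assms(2)] by metis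
  obtain B2 C2 \<theta>2 where B2: "prime_power_supported B2" "dser_abs_conv B2" "dser B2 holomorphic_on {s. Re s > 1}"
    "\<And>s. Re s > 1 \<Longrightarrow> exp (dser B2 s) = F\<^sub>2 s" "\<theta>2 < 1 / 2"
    "\<And>p k. prime p \<Longrightarrow> k \<ge> 1 \<Longrightarrow> norm (B2 (p ^ k)) \<le> C2 * real p powr (real k * \<theta>2)"
    using condition_II_imp_dser[OF assms(4)] by metis
  have len: "length [F\<^sub>1, F\<^sub>2] = 2" by simp
  obtain a :: "nat \<Rightarrow> nat \<Rightarrow> complex" and m :: "nat \<Rightarrow> nat \<Rightarrow> real"
    where a: "\<forall>i<2. dirichlet_series_for (a i) ([F\<^sub>1, F\<^sub>2] ! i)"
    and o: "\<forall>i<2. \<forall>j<2.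
      (\<lambda>x :: real. (\<Sum>p | prime p \<and> real p \<le> x. a i p * cnj (a j p) / of_nat p)
                - of_real (m i j) * of_real (ln (ln x)))
             \<in> o[at_top](\<lambda>x. of_real (ln (ln x)))"
    and m: "\<forall>i<2. m i i > 0" "\<forall>i<2. \<forall>j<2. i \<noteq> j \<longrightarrow> m i j = 0"
    using assms(5) unfolding orthogonal_functions_def len by (elim exE conjE) (rule that)
  have a1: "dirichlet_series_for (a 0) F\<^sub>1" and a2: "dirichlet_series_for (a 1) F\<^sub>2"
    using a[rule_format, of 0] a[rule_format, of 1] by auto
  have coeff1: "a 0 p = B1 p" if "prime p" for p
    by (rule exp_dser_prime_coeff_eq[OF dirichlet_series_for_imp_dser(1)[OF a1] B1(2) _
          prime_power_supported_1[OF B1(1)] that])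
       (simp add: B1(4) dirichlet_series_for_imp_dser(2)[OF a1])
  have coeff2: "a 1 p = B2 p" if "prime p" for p
    by (rule exp_dser_prime_coeff_eq[OF dirichlet_series_for_imp_dser(1)[OF a2] B2(2) _
          prime_power_supported_1[OF B2(1)] that])
       (simp add: B2(4) dirichlet_series_for_imp_dser(2)[OF a2])
  define \<theta> where "\<theta> = max \<theta>1 \<theta>2"
  \<comment> \<open>Absolute values make the constants nonnegative, so both bounds can be weakened
    to the common exponent \<open>\<theta>\<close>.\<close>
  define C where "C = \<bar>C1\<bar> + \<bar>C2\<bar>"
  define d where "d n = B1 n - B2 n" for n
  have d: "dser_abs_conv d"
    unfolding d_def[abs_def] by (rule dser_abs_conv_diff[OF B1(2) B2(2)])
  have dser_d: "dser d s = dser B1 s - dser B2 s" if "Re s > 1" for s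
    unfolding d_def[abs_def] by (rule dser_diff[OF B1(2) B2(2) that])
  \<comment> \<open>Being an exponential, \<open>F\<^sub>2\<close> has no zeros, so \<open>L\<close>
    can be divided by \<open>c\<^sub>1 * F\<^sub>2\<close>.\<close>
  have exp_d: "c\<^sub>1 * F\<^sub>1 s + c\<^sub>2 * F\<^sub>2 s = 0 \<longleftrightarrow> exp (dser d s) = - c\<^sub>2 / c\<^sub>1" if s: "Re s > 1" for s
  proof -
    have "F\<^sub>2 s \<noteq> 0" "F\<^sub>1 s = F\<^sub>2 s * exp (dser d s)"
      using B1(4)[OF s, symmetric] B2(4)[OF s, symmetric] by (simp_all add: dser_d[OF s] exp_diff)
    then have "c\<^sub>1 * F\<^sub>1 s + c\<^sub>2 * F\<^sub>2 s = c\<^sub>1 * F\<^sub>2 s * (exp (dser d s) - (- c\<^sub>2 / c\<^sub>1))"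
      using \<open>c\<^sub>1 \<noteq> 0\<close> by (simp add: field_simps)
    then show ?thesis
      using \<open>c\<^sub>1 \<noteq> 0\<close> \<open>F\<^sub>2 s \<noteq> 0\<close> by (simp only: mult_eq_0_iff right_minus_eq simp_thms)
  qed
  have pp: "prime_power_supported d"
    using B1(1) B2(1) unfolding prime_power_supported_def d_def by (metis diff_self)
  have hol: "dser d holomorphic_on {s. Re s > 1}"
  proof (rule holomorphic_transform)
    show "(\<lambda>s. dser B1 s - dser B2 s) holomorphic_on {s. Re s > 1}"
      by (intro holomorphic_intros B1 B2)
  qed (simp add: dser_d)
  have \<theta>: "\<theta> < 1 / 2" using B1(5) B2(5) by (simp add: \<theta>_def)
  have bound: "norm (d (p ^ k)) \<le> C * real p powr (real k * \<theta>)" if "prime p" "k \<ge> 1" for p k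
  proof -
    have mono: "C' * real p powr (real k * t) \<le> \<bar>C'\<bar> * real p powr (real k * \<theta>)" if "t \<le> \<theta>" for t C'
      using that prime_ge_1_nat[OF \<open>prime p\<close>] by (intro mult_mono powr_mono mult_left_mono) auto
    have "norm (d (p ^ k)) \<le> norm (B1 (p ^ k)) + norm (B2 (p ^ k))"
      unfolding d_def by (rule norm_triangle_ineq4)
    also have "\<dots> \<le> \<bar>C1\<bar> * real p powr (real k * \<theta>) + \<bar>C2\<bar> * real p powr (real k * \<theta>)"
      by (intro add_mono order_trans[OF B1(6)[OF that] mono] order_trans[OF B2(6)[OF that] mono])
         (auto simp: \<theta>_def)
    finally show ?thesis by (simp add: C_def distrib_right)
  qed
  \<comment> \<open>The exponent \<open>2 * \<theta> - 1\<close> is negative exactly because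
    \<open>\<theta> < 1 / 2\<close>, and at primes the coefficients of the functions and of their
    logarithms agree.\<close>
  have large: "\<exists>p\<ge>N. prime p \<and> norm (d p) > K * real p powr (2 * \<theta> - 1)" for K N
  proof -
    have "\<exists>p\<ge>N. prime p \<and> norm (a 0 p - a 1 p) > K * real p powr (2 * \<theta> - 1)"
      by (rule orthogonal_coeff_diff_large[of a m]) (use o m \<theta> in auto)
    moreover have "d p = a 0 p - a 1 p" if "prime p" for p
      by (simp only: d_def coeff1[OF that] coeff2[OF that])
    ultimately show ?thesis by metis
  qed
  obtain s where s: "Re s > 1" "0 < \<bar>Re s - Re \<rho>\<bar>" "\<bar>Re s - Re \<rho>\<bar> < \<delta>" "dser d s = dser d \<rho>"
    using dser_value_not_isolated[OF d pp hol \<theta> bound large \<rho>(1) \<open>\<delta> > 0\<close>] by metis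
  have "c\<^sub>1 * F\<^sub>1 s + c\<^sub>2 * F\<^sub>2 s = 0"
    using \<rho>(2) unfolding exp_d[OF \<rho>(1)] exp_d[OF s(1)] s(4) .
  then show False using isolated s by blast
qed

end
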